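(* Let $\beta\in(1,2]$, $b>0$, $\psi(r)=e^{br^\beta}$ for $r\ge b^{-1/\beta}$, and let $f:\mathbb{R}^d\to\mathbb{R}$ be an isotropic potential with twice continuously differentiable profile, with associated probability density $\pi=Z^{-1}e^{-f}$. Suppose that $f$ satisfies the strong convexity at infinity assumption with parameter $\rho$: there are $N_3,\rho>0$ such that for all $|x|>N_3$, $$f'(\psi(|x|))\psi'(|x|)|x|^{-1}-b\beta d|x|^{\beta-2}+(d-\beta)|x|^{-2}>\rho,$$ $$f''(\psi(|x|))\psi'(|x|)^2+f'(\psi(|x|))\psi''(|x|)-b\beta(\beta-1)d|x|^{\beta-2}-(d-\beta)|x|^{-2}>\rho.$$ Let $\vartheta$ be the parameter of the non-local Dirichlet form $\mathcal E$ given in the context. Then: (1) If $\beta\in(1,2)$, or $\beta=2$ and $\vartheta<\frac12\rho b^{-1}$, then $\pi$ satisfies the super Poincaré inequality (with rate function $S(r)$ as in the context) with $$\omega(x)=\frac{C}{2^{d+\vartheta}}|x|^{\frac12\rho b^{-\frac2\beta}\log^{\frac2\beta-1}(|x|)-\vartheta}\log^{-\frac{d-\beta}{\beta}}(|x|),$$ for some positive constant $C$. (2) If $\beta=2$, $\vartheta=\frac12\rho b^{-1}$ and $d=1,2$, then $\pi$ satisfies the Poincaré inequality. (3) If $\beta=2$, $\vartheta=\frac12\rho b^{-1}$ and $d\ge3$, or $\beta=2$ and $\vartheta>\frac12\rho b^{-1}$, then $\pi$ satisfies the weak Poincaré inequality (with rate function $W(r)$ as in the context).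
   Context: Isotropic: $f(x)=f(|x|)$, the same letter denoting a twice continuously differentiable profile $f:\mathbb{R}\to\mathbb{R}$; $f',f''$ are derivatives of the profile. $Z=\int e^{-f}$ is the (unknown) normalization constant. Dirichlet form: for the probability measure $\mu$ with density $\pi$, $\mathcal E(\phi)=\iint_{\{x\ne y\}}\frac{(\phi(x)-\phi(y))^2}{|x-y|^{d+\vartheta}}\,dx\,\mu(dy)$, the form associated with $\vartheta$-stable driven diffusions, with domain $\mathcal D(\mathcal E)=\{\phi\in L^2(\mu):\mathcal E(\phi)<\infty\}$. Write $\mu(\varphi)=\int\varphi\,d\mu$. Poincaré inequality: there is $C'>0$ with $\mathrm{Var}_\mu(\phi)\le C'\mathcal E(\phi)$ for all $\phi\in\mathcal D(\mathcal E)$. Weak Poincaré inequality: $\mathrm{Var}_\mu(\phi)\le W(r)\mathcal E(\phi)+r\|\phi\|_\infty^2$ for all $\phi\in\mathcal D(\mathcal E)$ and $r>0$, where $$W(r)=\inf_{s>0}\Big\{\frac{1}{\inf_{0<|x-y|\le s}[(e^{f(x)}+e^{f(y)})|x-y|^{-(d+\vartheta)}]}:\iint_{|x-y|>s}e^{-f(x)}e^{-f(y)}dxdy\le r/2\Big\}.$$ Super Poincaré inequality: $\mu(\phi^2)\le r\,\mathcal E(\phi)+S(r)\mu(|\phi|)^2$ for all $\phi\in\mathcal D(\mathcal E)$ and $r>0$, where, for a function $\omega$ depending on $f$, $$S(r)=\inf_{t,s>0}\Big\{\frac{2\mu(\omega)}{\inf_{|x|\ge t}\omega(x)}+S_t(t\wedge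 s):\frac{2}{\inf_{|x|\ge t}\omega(x)}+s\le r\Big\},$$ and for any $t>0$ $$S_t(s)=\inf_{u>0}\Big\{\frac{(\sup_{|z|\le2t}e^{f(z)})^2}{u^d\inf_{|z|\le t}e^{f(z)}}:\frac{u^\vartheta\sup_{|z|\le2t}e^{f(z)}}{\inf_{|z|\le t}e^{f(z)}}\le s\Big\}.$$
   Formalization: In (1) ω is given by the formula only for |x|≥R and is frozen at its value on |x|=R inside, for every R≥R₀ with R₀ depending on f and C depending on R; in (3) W is evaluated at the normalized potential f+log Z; as written, ω is undefined near 0 and both rates fail under shifts of f. *)

theory Defs
  imports "HOL-Probability.Probability"
begin

definition partition_const :: "('a::euclidean_space \<Rightarrow> real) \<Rightarrow> real" where
  "partition_const V = (\<integral>x. exp (- V x) \<partial>lborel)"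

definition gibbs :: "('a::euclidean_space \<Rightarrow> real) \<Rightarrow> 'a measure" where
  "gibbs V = density lborel (\<lambda>x. ennreal (exp (- V x) / partition_const V))"

(* The potential representing the same measure with normalization constant 1:
   exp (- normalized V x) is the density of gibbs V. The weak Poincare rate is evaluated at
   normalized V: it is not invariant under V + c although the measure is, and with
   an unnormalized V the inequality fails when partition_const V is small. *)
definition normalized :: "('a::euclidean_space \<Rightarrow> real) \<Rightarrow> 'a \<Rightarrow> real" where
  "normalized V x = V x + ln (partition_const V)"

definition dirichlet_form ::
  "'a::euclidean_space measure \<Rightarrow> real \<Rightarrow> ('a \<Rightarrow> real) \<Rightarrow> ennreal" where
  "dirichlet_form \<mu> \<theta> \<phi> =
     (\<integral>\<^sup>+y. (\<integral>\<^sup>+x\<in>{x. x \<noteq> y}.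
        ennreal ((\<phi> x - \<phi> y)\<^sup>2 / norm (x - y) powr (real DIM('a) + \<theta>)) \<partial>lborel) \<partial>\<mu>)"

definition dirichlet_domain ::
  "'a::euclidean_space measure \<Rightarrow> real \<Rightarrow> ('a \<Rightarrow> real) set" where
  "dirichlet_domain \<mu> \<theta> =
     {\<phi> \<in> borel_measurable \<mu>. integrable \<mu> (\<lambda>x. (\<phi> x)\<^sup>2) \<and> dirichlet_form \<mu> \<theta> \<phi> < \<infinity>}"

definition poincare_inequality :: "'a::euclidean_space measure \<Rightarrow> real \<Rightarrow> bool" where
  "poincare_inequality \<mu> \<theta> \<longleftrightarrow>
     (\<exists>C'>0. \<forall>\<phi>\<in>dirichlet_domain \<mu> \<theta>.
        ennreal (prob_space.variance \<mu> \<phi>) \<le> ennreal C' * dirichlet_form \<mu> \<theta> \<phi>)"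

(* Rate functions are extended-valued because they are infima of possibly empty sets
   (the infimum of the empty set is \<infinity>). Their finiteness is part of the inequalities
   below: an infinite rate would make them hold trivially. *)

definition weak_poincare_inequality ::
  "'a::euclidean_space measure \<Rightarrow> real \<Rightarrow> (real \<Rightarrow> ennreal) \<Rightarrow> bool" where
  "weak_poincare_inequality \<mu> \<theta> W \<longleftrightarrow>
     (\<forall>r>0. W r < \<infinity> \<and>
       (\<forall>\<phi>\<in>dirichlet_domain \<mu> \<theta>.
          ennreal (prob_space.variance \<mu> \<phi>)
            \<le> W r * dirichlet_form \<mu> \<theta> \<phi>
              + ennreal r * (esssup \<mu> (\<lambda>x. ennreal \<bar>\<phi> x\<bar>))\<^sup>2))"

definition super_poincare_inequality ::
  "'a::euclidean_space measure \<Rightarrow> real \<Rightarrow> (real \<Rightarrow> ennreal) \<Rightarrow> bool" where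
  "super_poincare_inequality \<mu> \<theta> S \<longleftrightarrow>
     (\<forall>r>0. S r < \<infinity> \<and>
       (\<forall>\<phi>\<in>dirichlet_domain \<mu> \<theta>.
          (\<integral>\<^sup>+x. ennreal ((\<phi> x)\<^sup>2) \<partial>\<mu>)
            \<le> ennreal r * dirichlet_form \<mu> \<theta> \<phi> + S r * (\<integral>\<^sup>+x. ennreal \<bar>\<phi> x\<bar> \<partial>\<mu>)\<^sup>2))"

definition weak_rate ::
  "real \<Rightarrow> ('a::euclidean_space \<Rightarrow> real) \<Rightarrow> real \<Rightarrow> ennreal" where
  "weak_rate \<theta> V r =
     (INF s\<in>{s. 0 < s \<and>
               (\<integral>\<^sup>+x. (\<integral>\<^sup>+y\<in>{y. norm (x - y) > s}.
                  ennreal (exp (- V x) * exp (- V y)) \<partial>lborel) \<partial>lborel) \<le> ennreal (r / 2)}.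
        1 / (INF (x, y)\<in>{(x, y). 0 < norm (x - y) \<and> norm (x - y) \<le> s}.
               ennreal ((exp (V x) + exp (V y)) * norm (x - y) powr (- (real DIM('a) + \<theta>)))))"

definition local_super_rate ::
  "real \<Rightarrow> ('a::euclidean_space \<Rightarrow> real) \<Rightarrow> real \<Rightarrow> real \<Rightarrow> ennreal" where
  "local_super_rate \<theta> V t s =
     (let M = (SUP z\<in>{z. norm z \<le> 2 * t}. ennreal (exp (V z)));
          m = (INF z\<in>{z. norm z \<le> t}. ennreal (exp (V z)))
      in INF u\<in>{u. 0 < u \<and> ennreal (u powr \<theta>) * M / m \<le> ennreal s}.
           M\<^sup>2 / (ennreal (u ^ DIM('a)) * m))"

definition super_rate ::
  "real \<Rightarrow> ('a::euclidean_space \<Rightarrow> real) \<Rightarrow> ('a \<Rightarrow> real) \<Rightarrow> real \<Rightarrow> ennreal" where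
  "super_rate \<theta> V \<omega> r =
     (let \<omega>_inf = (\<lambda>t. INF x\<in>{x. norm x \<ge> t}. ennreal (\<omega> x))
      in INF (t, s)\<in>{(t, s). 0 < t \<and> 0 < s \<and> 2 / \<omega>_inf t + ennreal s \<le> ennreal r}.
           2 * (\<integral>\<^sup>+x. ennreal (\<omega> x) \<partial>gibbs V) / \<omega>_inf t + local_super_rate \<theta> V t (min t s))"

(* For d = DIM('a), omega_profile d \<theta> \<beta> b \<rho> C (norm x) is the explicit formula for the weight.
   It makes sense only for norm x > 1 (powers of the logarithm), and for d > \<beta> it blows up
   as norm x tends to 1, so weight uses it outside the ball of radius R and extends it
   inside by its boundary value. *)
definition omega_profile ::
  "nat \<Rightarrow> real \<Rightarrow> real \<Rightarrow> real \<Rightarrow> real \<Rightarrow> real \<Rightarrow> real \<Rightarrow> real" where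
  "omega_profile d \<theta> \<beta> b \<rho> C r =
     C / 2 powr (real d + \<theta>)
       * r powr (1 / 2 * \<rho> * b powr (- 2 / \<beta>) * ln r powr (2 / \<beta> - 1) - \<theta>)
       * ln r powr (- (real d - \<beta>) / \<beta>)"

definition weight ::
  "real \<Rightarrow> real \<Rightarrow> real \<Rightarrow> real \<Rightarrow> real \<Rightarrow> real \<Rightarrow> 'a::euclidean_space \<Rightarrow> real" where
  "weight \<theta> \<beta> b \<rho> C R x = omega_profile DIM('a) \<theta> \<beta> b \<rho> C (max R (norm x))"

end

theory Submission
  imports Defs
begin

text \<open>Symmetrizing the Dirichlet form in its two variables shows that it dominates, up to a factor 2, the
  integral of \<open>k(x, y) (\<phi>(x) - \<phi>(y))\<^sup>2\<close> against \<open>\<mu> \<otimes> \<mu>\<close> for every kernel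
  \<open>k(x, y) \<le> (e\<^bsup>U(x)\<^esup> + e\<^bsup>U(y)\<^esup>) / |x - y|\<^bsup>d + \<theta>\<^esup>\<close>. A constant kernel gives the Poincare inequality,
  a kernel cut off at distance \<open>s\<close> the weak one, and a weight \<open>k(x, y) = 2 \<omega>(x)\<close> a weighted Poincare
  inequality, which controls \<open>\<phi>\<^sup>2\<close> far out; on balls \<open>\<phi>\<close> is compared with its local means.

  The first convexity condition says that \<open>f(\<psi>(r)) - d b r\<^bsup>\<beta>\<^esup> + (d - \<beta>) log r - \<rho> r\<^sup>2 / 2\<close> increases.
  Substituting \<open>\<psi>(r) = R\<close>, this bounds \<open>e\<^bsup>f(R)\<^esup>\<close> from below by a multiple of \<open>R\<^bsup>d + \<theta>\<^esup>\<close> times the profile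
  of the weight, and the three cases are those in which this profile tends to infinity, stays
  bounded below, or may tend to zero.\<close>

section \<open>Kernels dominated by the Dirichlet form\<close>

lemma le_INF_mult_add:
  fixes E D N :: ennreal and c :: "'i \<Rightarrow> ennreal"
  assumes "I \<noteq> {}" "E < \<top>" and le: "\<And>i. i \<in> I \<Longrightarrow> N \<le> D + c i * E"
  shows "N \<le> D + (INF i\<in>I. c i) * E"
proof (cases "E = 0 \<or> D = \<top>")
  case True
  then show ?thesis using assms by fastforce
next
  case False
  have "(N - D) / E \<le> c i" if "i \<in> I" for i
  proof (rule divide_le_posI_ennreal)
    show "N - D \<le> E * c i"
      using le[OF that] False by (simp add: ennreal_minus_le_iff mult.commute)
  qed (use False in \<open>simp add: zero_less_iff_neq_zero\<close>)
  then have "(N - D) / E \<le> (INF i\<in>I. c i)" by (rule INF_greatest)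
  then have "(N - D) / E * E \<le> (INF i\<in>I. c i) * E" by (rule mult_right_mono) simp
  then have "N - D \<le> (INF i\<in>I. c i) * E"
    using False \<open>E < \<top>\<close> by (simp add: ennreal_divide_times)
  then show ?thesis by (metis add.commute diff_add_cancel_ennreal add_left_mono ennreal_minus_le_iff)
qed

lemma ennreal_square_le_two_sum:
  fixes a b c :: ennreal
  assumes "a \<le> b + c"
  shows "a\<^sup>2 \<le> 2 * b\<^sup>2 + 2 * c\<^sup>2"
proof (cases "b = \<top> \<or> c = \<top>")
  case True
  then show ?thesis by (auto simp: ennreal_mult_top power2_eq_square)
next
  case False
  then obtain b' c' where bc: "b = ennreal b'" "c = ennreal c'" "0 \<le> b'" "0 \<le> c'"
    by (metis ennreal_cases)
  have "a\<^sup>2 \<le> (b + c)\<^sup>2" using assms by (simp add: power_mono)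
  also have "\<dots> = ennreal ((b' + c')\<^sup>2)"
    using bc by (simp add: ennreal_power[symmetric])
  also have "\<dots> \<le> ennreal (2 * b'\<^sup>2 + 2 * c'\<^sup>2)"
    using sum_squares_bound[of b' c'] by (intro ennreal_leI) (simp add: power2_sum)
  also have "\<dots> = 2 * b\<^sup>2 + 2 * c\<^sup>2"
    using bc by (simp add: ennreal_plus ennreal_mult ennreal_power)
  finally show ?thesis .
qed

context prob_space
begin

lemma nn_integral_square_diff:
  fixes \<phi> :: "'a \<Rightarrow> real"
  assumes [measurable]: "\<phi> \<in> borel_measurable M" and sq: "integrable M (\<lambda>x. (\<phi> x)\<^sup>2)"
  shows "(\<integral>\<^sup>+y. ennreal ((c - \<phi> y)\<^sup>2) \<partial>M) = ennreal ((c - expectation \<phi>)\<^sup>2 + variance \<phi>)"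
proof -
  have int: "integrable M \<phi>" by (rule square_integrable_imp_integrable) (use sq in auto)
  have "(\<integral>\<^sup>+y. ennreal ((c - \<phi> y)\<^sup>2) \<partial>M) = ennreal (expectation (\<lambda>y. (c - \<phi> y)\<^sup>2))"
  proof (intro nn_integral_eq_integral)
    show "integrable M (\<lambda>y. (c - \<phi> y)\<^sup>2)" using sq int by (simp add: power2_diff)
  qed simp
  also have "expectation (\<lambda>y. (c - \<phi> y)\<^sup>2) = c\<^sup>2 + expectation (\<lambda>y. (\<phi> y)\<^sup>2) - 2 * c * expectation \<phi>"
    using sq int by (simp add: power2_diff prob_space)
  also have "\<dots> = (c - expectation \<phi>)\<^sup>2 + variance \<phi>"
    using sq int by (simp add: variance_eq prob_space power2_eq_square algebra_simps)
  finally show ?thesis .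
qed

lemma nn_integral_nn_integral_square_diff:
  fixes \<phi> :: "'a \<Rightarrow> real"
  assumes [measurable]: "\<phi> \<in> borel_measurable M" and sq: "integrable M (\<lambda>x. (\<phi> x)\<^sup>2)"
  shows "(\<integral>\<^sup>+x. \<integral>\<^sup>+y. ennreal ((\<phi> x - \<phi> y)\<^sup>2) \<partial>M \<partial>M) = ennreal (2 * variance \<phi>)"
proof -
  have "(\<integral>\<^sup>+x. \<integral>\<^sup>+y. ennreal ((\<phi> x - \<phi> y)\<^sup>2) \<partial>M \<partial>M)
      = (\<integral>\<^sup>+x. ennreal ((expectation \<phi> - \<phi> x)\<^sup>2) + ennreal (variance \<phi>) \<partial>M)"
    by (simp add: nn_integral_square_diff[OF assms] ennreal_plus power2_commute[of "expectation \<phi>"])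
  also have "\<dots> = ennreal (variance \<phi>) + ennreal (variance \<phi>)"
    by (subst nn_integral_add) (auto simp: nn_integral_square_diff[OF assms] emeasure_space_1)
  finally show ?thesis by (simp flip: ennreal_plus)
qed

end

text \<open>Here \<^term>\<open>U\<close> plays the role of the normalized potential, at which the weak rate is evaluated.\<close>

locale gibbs_density =
  fixes U :: "'a::euclidean_space \<Rightarrow> real" and \<mu> :: "'a measure"
  assumes continuous: "continuous_on UNIV U"
    and mass: "(\<integral>\<^sup>+x. ennreal (exp (- U x)) \<partial>lborel) = 1"
    and \<mu>_eq: "\<mu> = density lborel (\<lambda>x. ennreal (exp (- U x)))"
begin

lemma borel_measurable_U [measurable]: "U \<in> borel_measurable borel"
  using continuous by (rule borel_measurable_continuous_onI)

lemma sets_\<mu> [measurable_cong, simp]: "sets \<mu> = sets borel"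
  and space_\<mu> [simp]: "space \<mu> = UNIV"
  by (simp_all add: \<mu>_eq)

lemma measurable_\<mu> [simp]: "borel_measurable \<mu> = borel_measurable borel"
  by (rule measurable_cong_sets) simp_all

lemma prob_space_\<mu>: "prob_space \<mu>"
  by (rule prob_spaceI) (simp add: \<mu>_eq emeasure_density mass)

sublocale prob_space \<mu>
  by (rule prob_space_\<mu>)

lemma nn_integral_\<mu>:
  assumes "h \<in> borel_measurable borel"
  shows "(\<integral>\<^sup>+x. h x \<partial>\<mu>) = (\<integral>\<^sup>+x. ennreal (exp (- U x)) * h x \<partial>lborel)"
  unfolding \<mu>_eq using assms by (intro nn_integral_density) auto

lemma nn_integral_kernel_le_dirichlet_form:
  fixes k :: "'a \<Rightarrow> 'a \<Rightarrow> ennreal"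
  assumes [measurable]: "\<phi> \<in> borel_measurable borel" "case_prod k \<in> borel_measurable (borel \<Otimes>\<^sub>M borel)"
    and k: "\<And>x y. x \<noteq> y \<Longrightarrow>
      k x y \<le> ennreal ((exp (U x) + exp (U y)) * norm (x - y) powr (- (real DIM('a) + \<theta>)))"
  shows "(\<integral>\<^sup>+x. \<integral>\<^sup>+y. k x y * ennreal ((\<phi> x - \<phi> y)\<^sup>2) \<partial>\<mu> \<partial>\<mu>) \<le> 2 * dirichlet_form \<mu> \<theta> \<phi>"
proof -
  define g where "g x y = ennreal ((\<phi> x - \<phi> y)\<^sup>2 / norm (x - y) powr (real DIM('a) + \<theta>))" for x y
  have g_sym: "g x y = g y x" for x y by (simp add: g_def power2_commute norm_minus_commute)
  have [measurable]: "case_prod g \<in> borel_measurable (borel \<Otimes>\<^sub>M borel)"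
    unfolding g_def by measurable
  let ?w = "\<lambda>x. ennreal (exp (- U x))"
  have "?w y * k x y * ?w x * ennreal ((\<phi> x - \<phi> y)\<^sup>2) \<le> g x y * ?w x + g x y * ?w y" for x y
  proof (cases "x = y")
    case False
    have "?w y * k x y * ?w x * ennreal ((\<phi> x - \<phi> y)\<^sup>2)
      \<le> ?w y * ennreal ((exp (U x) + exp (U y)) * norm (x - y) powr (- (real DIM('a) + \<theta>))) * ?w x
        * ennreal ((\<phi> x - \<phi> y)\<^sup>2)"
      by (intro mult_right_mono mult_left_mono k False) auto
    also have "\<dots> = ennreal (exp (- U y) * ((exp (U x) + exp (U y)) * norm (x - y) powr (- (real DIM('a) + \<theta>)))
        * exp (- U x) * (\<phi> x - \<phi> y)\<^sup>2)"
      by (simp add: ennreal_mult)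
    also have "\<dots> = ennreal ((\<phi> x - \<phi> y)\<^sup>2 / norm (x - y) powr (real DIM('a) + \<theta>) * exp (- U x)
        + (\<phi> x - \<phi> y)\<^sup>2 / norm (x - y) powr (real DIM('a) + \<theta>) * exp (- U y))"
      using False unfolding powr_minus exp_minus
      by (intro arg_cong[where f=ennreal]) (simp add: divide_simps, simp add: algebra_simps)
    also have "\<dots> = g x y * ?w x + g x y * ?w y"
      unfolding g_def by (simp add: ennreal_plus flip: ennreal_mult)
    finally show ?thesis .
  qed simp
  note le = this
  have form: "dirichlet_form \<mu> \<theta> \<phi> = (\<integral>\<^sup>+y. \<integral>\<^sup>+x. g x y * ?w y \<partial>lborel \<partial>lborel)"
  proof -
    have "dirichlet_form \<mu> \<theta> \<phi> = (\<integral>\<^sup>+y. \<integral>\<^sup>+x. g x y \<partial>lborel \<partial>\<mu>)"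
      unfolding dirichlet_form_def g_def
      by (intro nn_integral_cong) (auto simp: indicator_def split: if_splits)
    also have "\<dots> = (\<integral>\<^sup>+y. \<integral>\<^sup>+x. g x y * ?w y \<partial>lborel \<partial>lborel)"
      by (simp add: nn_integral_\<mu> nn_integral_cmult[symmetric] mult.commute)
    finally show ?thesis .
  qed
  have "(\<integral>\<^sup>+x. \<integral>\<^sup>+y. k x y * ennreal ((\<phi> x - \<phi> y)\<^sup>2) \<partial>\<mu> \<partial>\<mu>)
      = (\<integral>\<^sup>+x. \<integral>\<^sup>+y. ?w y * k x y * ?w x * ennreal ((\<phi> x - \<phi> y)\<^sup>2) \<partial>lborel \<partial>lborel)"
    by (simp add: nn_integral_\<mu> nn_integral_cmult[symmetric] ac_simps)
  also have "\<dots> \<le> (\<integral>\<^sup>+x. \<integral>\<^sup>+y. g x y * ?w x + g x y * ?w y \<partial>lborel \<partial>lborel)"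
    by (intro nn_integral_mono le)
  also have "\<dots> = (\<integral>\<^sup>+x. \<integral>\<^sup>+y. g x y * ?w x \<partial>lborel \<partial>lborel) + (\<integral>\<^sup>+x. \<integral>\<^sup>+y. g x y * ?w y \<partial>lborel \<partial>lborel)"
    by (simp add: nn_integral_add)
  also have "(\<integral>\<^sup>+x. \<integral>\<^sup>+y. g x y * ?w x \<partial>lborel \<partial>lborel) = dirichlet_form \<mu> \<theta> \<phi>"
    unfolding form by (simp add: g_sym)
  also have "(\<integral>\<^sup>+x. \<integral>\<^sup>+y. g x y * ?w y \<partial>lborel \<partial>lborel) = dirichlet_form \<mu> \<theta> \<phi>"
    unfolding form by (intro lborel_pair.Fubini') simp
  finally show ?thesis by (simp add: mult_2)
qed

lemma dirichlet_domainD: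
  assumes "\<phi> \<in> dirichlet_domain \<mu> \<theta>"
  shows "\<phi> \<in> borel_measurable borel" "integrable \<mu> (\<lambda>x. (\<phi> x)\<^sup>2)" "dirichlet_form \<mu> \<theta> \<phi> < \<top>"
  using assms by (auto simp: dirichlet_domain_def)

lemma poincare_of_kernel_ge:
  assumes \<phi>: "\<phi> \<in> dirichlet_domain \<mu> \<theta>" and "c > 0"
    and c: "\<And>x y. x \<noteq> y \<Longrightarrow>
      c \<le> (exp (U x) + exp (U y)) * norm (x - y) powr (- (real DIM('a) + \<theta>))"
  shows "ennreal (variance \<phi>) \<le> ennreal (1 / c) * dirichlet_form \<mu> \<theta> \<phi>"
proof -
  note [measurable] = dirichlet_domainD(1)[OF \<phi>]
  have "ennreal c * ennreal (2 * variance \<phi>)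
      = (\<integral>\<^sup>+x. \<integral>\<^sup>+y. ennreal c * ennreal ((\<phi> x - \<phi> y)\<^sup>2) \<partial>\<mu> \<partial>\<mu>)"
    by (simp add: nn_integral_cmult nn_integral_nn_integral_square_diff dirichlet_domainD[OF \<phi>])
  also have "\<dots> \<le> 2 * dirichlet_form \<mu> \<theta> \<phi>"
    by (rule nn_integral_kernel_le_dirichlet_form) (measurable, rule ennreal_leI[OF c])
  finally have "ennreal (1 / (2 * c)) * (ennreal c * ennreal (2 * variance \<phi>))
      \<le> ennreal (1 / (2 * c)) * (2 * dirichlet_form \<mu> \<theta> \<phi>)"
    by (rule mult_left_mono) simp
  also have "ennreal (1 / (2 * c)) * (ennreal c * ennreal (2 * variance \<phi>)) = ennreal (variance \<phi>)"
    using \<open>c > 0\<close> by (simp flip: ennreal_mult)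
  also have "ennreal (1 / (2 * c)) * (2 * dirichlet_form \<mu> \<theta> \<phi>) = ennreal (1 / (2 * c) * 2) * dirichlet_form \<mu> \<theta> \<phi>"
    using \<open>c > 0\<close> by (subst ennreal_mult) (auto simp: mult.assoc)
  finally show ?thesis by simp
qed

lemma weighted_poincare:
  fixes \<omega> :: "'a \<Rightarrow> real"
  assumes \<phi>: "\<phi> \<in> dirichlet_domain \<mu> \<theta>" and [measurable]: "\<omega> \<in> borel_measurable borel"
    and \<omega>: "\<And>x. 0 \<le> \<omega> x" "\<And>x y. x \<noteq> y \<Longrightarrow>
      2 * \<omega> x \<le> (exp (U x) + exp (U y)) * norm (x - y) powr (- (real DIM('a) + \<theta>))"
  shows "(\<integral>\<^sup>+x. ennreal (\<omega> x) * ennreal ((\<phi> x - expectation \<phi>)\<^sup>2) \<partial>\<mu>) \<le> dirichlet_form \<mu> \<theta> \<phi>"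
proof -
  note [measurable] = dirichlet_domainD(1)[OF \<phi>]
  have "2 * (\<integral>\<^sup>+x. ennreal (\<omega> x) * ennreal ((\<phi> x - expectation \<phi>)\<^sup>2) \<partial>\<mu>)
      = (\<integral>\<^sup>+x. ennreal (2 * \<omega> x) * ennreal ((\<phi> x - expectation \<phi>)\<^sup>2) \<partial>\<mu>)"
    using \<omega>(1) by (subst nn_integral_cmult[symmetric]) (auto simp: ennreal_mult mult.assoc)
  also have "\<dots> \<le> (\<integral>\<^sup>+x. ennreal (2 * \<omega> x) * (\<integral>\<^sup>+y. ennreal ((\<phi> x - \<phi> y)\<^sup>2) \<partial>\<mu>) \<partial>\<mu>)"
    by (intro nn_integral_mono mult_left_mono)
      (auto simp: nn_integral_square_diff dirichlet_domainD[OF \<phi>] intro!: ennreal_leI)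
  also have "\<dots> = (\<integral>\<^sup>+x. \<integral>\<^sup>+y. ennreal (2 * \<omega> x) * ennreal ((\<phi> x - \<phi> y)\<^sup>2) \<partial>\<mu> \<partial>\<mu>)"
    by (simp add: nn_integral_cmult)
  also have "\<dots> \<le> 2 * dirichlet_form \<mu> \<theta> \<phi>"
    by (rule nn_integral_kernel_le_dirichlet_form) (measurable, rule ennreal_leI[OF \<omega>(2)])
  finally show ?thesis
    by (subst (asm) ennreal_mult_le_mult_iff) auto
qed

text \<open>Each value is compared with the mean over the ball of radius \<^term>\<open>u\<close>: the increments are
  controlled by the Dirichlet form, the mean by the first absolute moment.\<close>

lemma nn_integral_cball_square_le:
  assumes [measurable]: "\<phi> \<in> borel_measurable borel"
    and u: "0 < u" "u \<le> t" and \<theta>: "0 < \<theta>" and m: "0 < m"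
    and M: "\<And>z. norm z \<le> 2 * t \<Longrightarrow> exp (U z) \<le> M"
    and mU: "\<And>z. norm z \<le> t \<Longrightarrow> m \<le> exp (U z)"
  defines "v \<equiv> unit_ball_vol (real DIM('a))"
  shows "(\<integral>\<^sup>+x. ennreal ((\<phi> x)\<^sup>2) * indicator (cball 0 t) x \<partial>\<mu>)
    \<le> ennreal (2 * u powr \<theta> / v) * dirichlet_form \<mu> \<theta> \<phi>
      + ennreal (2 * M\<^sup>2 / (v * u ^ DIM('a) * m)) * (\<integral>\<^sup>+x. ennreal \<bar>\<phi> x\<bar> \<partial>\<mu>)\<^sup>2"
proof -
  let ?p = "real DIM('a) + \<theta>"
  let ?L = "\<integral>\<^sup>+x. ennreal \<bar>\<phi> x\<bar> \<partial>\<mu>"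
  let ?I = "\<lambda>x y. indicator (ball x u) y :: ennreal"
  define vol where "vol = v * u ^ DIM('a)"
  have v: "v > 0" by (simp add: v_def)
  then have vol: "vol > 0" using u by (simp add: vol_def)
  have vol_ball: "emeasure lborel (ball x u) = ennreal vol" for x :: 'a
    using u by (simp add: emeasure_ball vol_def v_def)
  have M0: "M > 0" using M[of 0] u by (smt (verit) exp_gt_zero norm_zero)
  define g where "g x y = ennreal ((\<phi> y - \<phi> x)\<^sup>2 / norm (y - x) powr ?p)" for x y
  have [measurable]: "case_prod g \<in> borel_measurable (borel \<Otimes>\<^sub>M borel)"
    unfolding g_def by measurable
  define G where "G x = (\<integral>\<^sup>+y. g x y \<partial>lborel)" for x
  define a where "a x = (\<integral>\<^sup>+y. ?I x y * ennreal \<bar>\<phi> y\<bar> \<partial>lborel)" for x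
  define Q where "Q = (\<integral>\<^sup>+y. indicator (cball 0 (2 * t)) y * ennreal \<bar>\<phi> y\<bar> \<partial>lborel)"
  have I_eq: "?I x y = indicator {p. dist (fst p) (snd p) < u} (x, y)" for x y
    by (auto simp: indicator_def)
  have [measurable]: "?I x \<in> borel_measurable borel" for x
    by (rule borel_measurable_indicator) simp
  have [measurable]: "cball (0 :: 'a) s \<in> sets borel" for s
    by simp
  have [measurable]: "G \<in> borel_measurable borel" "a \<in> borel_measurable borel"
    unfolding G_def a_def I_eq by measurable
  have form: "dirichlet_form \<mu> \<theta> \<phi> = (\<integral>\<^sup>+x. G x \<partial>\<mu>)"
    unfolding dirichlet_form_def G_def g_def
    by (intro nn_integral_cong) (auto simp: indicator_def split: if_splits)
  have pointwise: "ennreal (vol\<^sup>2) * ennreal ((\<phi> x)\<^sup>2) \<le> ennreal (2 * vol * u powr ?p) * G x + 2 * (a x)\<^sup>2" for x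
  proof -
    define D where "D = (\<integral>\<^sup>+y. ?I x y * ennreal \<bar>\<phi> x - \<phi> y\<bar> \<partial>lborel)"
    have "ennreal vol * ennreal \<bar>\<phi> x\<bar> = (\<integral>\<^sup>+y. ?I x y * ennreal \<bar>\<phi> x\<bar> \<partial>lborel)"
      by (subst nn_integral_multc) (auto simp: vol_ball)
    also have "\<dots> \<le> (\<integral>\<^sup>+y. ?I x y * ennreal \<bar>\<phi> x - \<phi> y\<bar> + ?I x y * ennreal \<bar>\<phi> y\<bar> \<partial>lborel)"
      by (intro nn_integral_mono) (auto simp: indicator_def simp flip: ennreal_plus intro!: ennreal_leI)
    also have "\<dots> = D + a x"
      unfolding D_def a_def by (rule nn_integral_add) measurable
    finally have "(ennreal vol * ennreal \<bar>\<phi> x\<bar>)\<^sup>2 \<le> 2 * D\<^sup>2 + 2 * (a x)\<^sup>2"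
      by (rule ennreal_square_le_two_sum)
    moreover have "D\<^sup>2 \<le> ennreal (vol * u powr ?p) * G x"
    proof -
      have "D\<^sup>2 = (\<integral>\<^sup>+y. (?I x y * ennreal \<bar>\<phi> x - \<phi> y\<bar>) * ?I x y \<partial>lborel)\<^sup>2"
        unfolding D_def by (intro arg_cong[where f="\<lambda>z. z\<^sup>2"] nn_integral_cong) (auto simp: indicator_def)
      also have "\<dots> \<le> (\<integral>\<^sup>+y. (?I x y * ennreal \<bar>\<phi> x - \<phi> y\<bar>)\<^sup>2 \<partial>lborel) * (\<integral>\<^sup>+y. (?I x y)\<^sup>2 \<partial>lborel)"
        by (rule Cauchy_Schwarz_nn_integral) measurable
      also have "(\<integral>\<^sup>+y. (?I x y)\<^sup>2 \<partial>lborel) = (\<integral>\<^sup>+y. ?I x y \<partial>lborel)"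
        by (intro nn_integral_cong) (auto simp: indicator_def)
      also have "\<dots> = ennreal vol" by (simp add: vol_ball)
      also have "(\<integral>\<^sup>+y. (?I x y * ennreal \<bar>\<phi> x - \<phi> y\<bar>)\<^sup>2 \<partial>lborel) \<le> (\<integral>\<^sup>+y. ennreal (u powr ?p) * g x y \<partial>lborel)"
      proof (intro nn_integral_mono)
        fix y
        show "(?I x y * ennreal \<bar>\<phi> x - \<phi> y\<bar>)\<^sup>2 \<le> ennreal (u powr ?p) * g x y"
        proof (cases "y = x \<or> dist x y \<ge> u")
          case False
          then have n: "norm (y - x) > 0" "norm (y - x) \<le> u" by (auto simp: dist_norm norm_minus_commute)
          have "(\<phi> y - \<phi> x)\<^sup>2 * norm (y - x) powr ?p \<le> (\<phi> y - \<phi> x)\<^sup>2 * u powr ?p"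
            using n \<theta> by (intro mult_left_mono powr_mono2) auto
          then have "(\<phi> y - \<phi> x)\<^sup>2 \<le> u powr ?p * ((\<phi> y - \<phi> x)\<^sup>2 / norm (y - x) powr ?p)"
            using n by (simp add: field_simps)
          then show ?thesis using False
            by (auto simp: g_def ennreal_power power2_commute[of "\<phi> x"] simp flip: ennreal_mult intro!: ennreal_leI)
        qed auto
      qed
      also have "\<dots> = ennreal (u powr ?p) * G x"
        unfolding G_def by (rule nn_integral_cmult) simp
      finally have "D\<^sup>2 \<le> ennreal (u powr ?p) * G x * ennreal vol" by (simp add: mult_right_mono)
      also have "\<dots> = ennreal (vol * u powr ?p) * G x"
        using vol by (simp add: ennreal_mult ac_simps)
      finally show ?thesis .
    qed
    ultimately have "(ennreal vol * ennreal \<bar>\<phi> x\<bar>)\<^sup>2 \<le> 2 * (ennreal (vol * u powr ?p) * G x) + 2 * (a x)\<^sup>2"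
      by (meson add_right_mono mult_left_mono order_trans zero_le)
    moreover have "(ennreal \<bar>\<phi> x\<bar>)\<^sup>2 = ennreal ((\<phi> x)\<^sup>2)"
      by (simp add: ennreal_power)
    ultimately show ?thesis
      using vol by (simp add: ennreal_mult power_mult_distrib mult.assoc flip: ennreal_power)
  qed
  have Q_le: "Q \<le> ennreal M * ?L"
  proof -
    have "Q \<le> (\<integral>\<^sup>+y. ennreal M * (ennreal (exp (- U y)) * ennreal \<bar>\<phi> y\<bar>) \<partial>lborel)"
      unfolding Q_def
    proof (intro nn_integral_mono)
      fix y
      show "indicator (cball 0 (2 * t)) y * ennreal \<bar>\<phi> y\<bar> \<le> ennreal M * (ennreal (exp (- U y)) * ennreal \<bar>\<phi> y\<bar>)"
      proof (cases "norm y \<le> 2 * t")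
        case True
        then have "1 \<le> M * exp (- U y)" using M[of y] by (simp add: exp_minus field_simps)
        then have "\<bar>\<phi> y\<bar> \<le> M * (exp (- U y) * \<bar>\<phi> y\<bar>)"
          by (metis abs_ge_zero mult.assoc mult_1 mult_right_mono)
        then show ?thesis using True M0 by (auto simp flip: ennreal_mult intro!: ennreal_leI)
      qed auto
    qed
    also have "\<dots> = ennreal M * ?L" by (simp add: nn_integral_cmult nn_integral_\<mu>)
    finally show ?thesis .
  qed
  have a_le: "a x \<le> Q" if "x \<in> cball 0 t" for x
    unfolding a_def Q_def
  proof (intro nn_integral_mono mult_right_mono)
    fix y :: 'a
    have "y \<in> cball 0 (2 * t)" if "y \<in> ball x u"
      using that \<open>x \<in> cball 0 t\<close> u norm_triangle_ineq2[of y x] by (auto simp: dist_norm norm_minus_commute)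
    then show "?I x y \<le> indicator (cball 0 (2 * t)) y" by (auto simp: indicator_def)
  qed simp
  have a_int: "(\<integral>\<^sup>+x. a x * indicator (cball 0 t) x \<partial>\<mu>) \<le> ennreal (vol / m) * Q"
  proof -
    have "(\<integral>\<^sup>+x. a x * indicator (cball 0 t) x \<partial>\<mu>)
        = (\<integral>\<^sup>+x. ennreal (exp (- U x)) * (a x * indicator (cball 0 t) x) \<partial>lborel)"
      by (rule nn_integral_\<mu>) measurable
    also have "\<dots> \<le> (\<integral>\<^sup>+x. ennreal (1 / m) * (a x * indicator (cball 0 t) x) \<partial>lborel)"
    proof (intro nn_integral_mono)
      fix x
      show "ennreal (exp (- U x)) * (a x * indicator (cball 0 t) x) \<le> ennreal (1 / m) * (a x * indicator (cball 0 t) x)"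
      proof (cases "norm x \<le> t")
        case True
        then have "exp (- U x) \<le> 1 / m" using mU[of x] m by (simp add: exp_minus field_simps)
        then show ?thesis by (intro mult_right_mono ennreal_leI) auto
      qed auto
    qed
    also have "\<dots> = ennreal (1 / m) * (\<integral>\<^sup>+x. a x * indicator (cball 0 t) x \<partial>lborel)"
      by (rule nn_integral_cmult) measurable
    also have "(\<integral>\<^sup>+x. a x * indicator (cball 0 t) x \<partial>lborel)
        = (\<integral>\<^sup>+x. \<integral>\<^sup>+y. ?I x y * ennreal \<bar>\<phi> y\<bar> * indicator (cball 0 t) x \<partial>lborel \<partial>lborel)"
      unfolding a_def by (simp add: nn_integral_multc)
    also have "\<dots> \<le> (\<integral>\<^sup>+x. \<integral>\<^sup>+y. ?I y x * (indicator (cball 0 (2 * t)) y * ennreal \<bar>\<phi> y\<bar>) \<partial>lborel \<partial>lborel)"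
    proof (intro nn_integral_mono)
      fix x y :: 'a
      have "y \<in> cball 0 (2 * t)" if "y \<in> ball x u" "x \<in> cball 0 t"
        using that u norm_triangle_ineq2[of y x] by (auto simp: dist_norm norm_minus_commute)
      then show "?I x y * ennreal \<bar>\<phi> y\<bar> * indicator (cball 0 t) x
          \<le> ?I y x * (indicator (cball 0 (2 * t)) y * ennreal \<bar>\<phi> y\<bar>)"
        by (auto simp: indicator_def dist_commute)
    qed
    also have "\<dots> = (\<integral>\<^sup>+y. \<integral>\<^sup>+x. ?I y x * (indicator (cball 0 (2 * t)) y * ennreal \<bar>\<phi> y\<bar>) \<partial>lborel \<partial>lborel)"
      unfolding I_eq by (intro lborel_pair.Fubini') measurable
    also have "\<dots> = ennreal vol * Q"
      unfolding Q_def by (simp add: nn_integral_multc nn_integral_cmult vol_ball)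
    finally show ?thesis
      using vol m by (simp add: mult.assoc[symmetric] mult_left_mono flip: ennreal_mult)
  qed
  have "ennreal (vol\<^sup>2) * (\<integral>\<^sup>+x. ennreal ((\<phi> x)\<^sup>2) * indicator (cball 0 t) x \<partial>\<mu>)
      = (\<integral>\<^sup>+x. ennreal (vol\<^sup>2) * ennreal ((\<phi> x)\<^sup>2) * indicator (cball 0 t) x \<partial>\<mu>)"
    by (subst nn_integral_cmult[symmetric]) (auto simp: mult.assoc)
  also have "\<dots> \<le> (\<integral>\<^sup>+x. ennreal (2 * vol * u powr ?p) * G x + 2 * Q * (a x * indicator (cball 0 t) x) \<partial>\<mu>)"
  proof (intro nn_integral_mono)
    fix x
    show "ennreal (vol\<^sup>2) * ennreal ((\<phi> x)\<^sup>2) * indicator (cball 0 t) x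
       \<le> ennreal (2 * vol * u powr ?p) * G x + 2 * Q * (a x * indicator (cball 0 t) x)"
    proof (cases "x \<in> cball 0 t")
      case True
      have "(a x)\<^sup>2 \<le> Q * a x"
        using a_le[OF True] by (simp add: power2_eq_square mult_right_mono)
      then have "2 * (a x)\<^sup>2 \<le> 2 * Q * a x" by (simp add: mult.assoc mult_left_mono)
      then show ?thesis using pointwise[of x] True
        by (simp add: order_trans[OF _ add_left_mono])
    qed simp
  qed
  also have "\<dots> = ennreal (2 * vol * u powr ?p) * dirichlet_form \<mu> \<theta> \<phi>
      + 2 * Q * (\<integral>\<^sup>+x. a x * indicator (cball 0 t) x \<partial>\<mu>)"
    by (simp add: nn_integral_add nn_integral_cmult form)
  also have "\<dots> \<le> ennreal (2 * vol * u powr ?p) * dirichlet_form \<mu> \<theta> \<phi>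
      + 2 * (ennreal M * ?L) * (ennreal (vol / m) * (ennreal M * ?L))"
    by (intro add_left_mono mult_mono order_trans[OF a_int] mult_left_mono Q_le) auto
  also have "2 * (ennreal M * ?L) * (ennreal (vol / m) * (ennreal M * ?L))
      = ennreal (2 * vol * M\<^sup>2 / m) * ?L\<^sup>2"
  proof -
    have "ennreal (2 * vol * M\<^sup>2 / m) = 2 * ennreal M * ennreal (vol / m) * ennreal M"
      using vol m M0 by (simp add: power2_eq_square flip: ennreal_mult ennreal_numeral)
    then show ?thesis by (simp add: power2_eq_square ac_simps)
  qed
  finally have "ennreal (1 / vol\<^sup>2) * (ennreal (vol\<^sup>2) * (\<integral>\<^sup>+x. ennreal ((\<phi> x)\<^sup>2) * indicator (cball 0 t) x \<partial>\<mu>))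
     \<le> ennreal (1 / vol\<^sup>2) * (ennreal (2 * vol * u powr ?p) * dirichlet_form \<mu> \<theta> \<phi> + ennreal (2 * vol * M\<^sup>2 / m) * ?L\<^sup>2)"
    by (rule mult_left_mono) simp
  also have "ennreal (1 / vol\<^sup>2) * (ennreal (vol\<^sup>2) * (\<integral>\<^sup>+x. ennreal ((\<phi> x)\<^sup>2) * indicator (cball 0 t) x \<partial>\<mu>))
     = (\<integral>\<^sup>+x. ennreal ((\<phi> x)\<^sup>2) * indicator (cball 0 t) x \<partial>\<mu>)"
    using vol by (simp add: mult.assoc[symmetric] flip: ennreal_mult)
  also have "ennreal (1 / vol\<^sup>2) * (ennreal (2 * vol * u powr ?p) * dirichlet_form \<mu> \<theta> \<phi> + ennreal (2 * vol * M\<^sup>2 / m) * ?L\<^sup>2)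
     = ennreal (1 / vol\<^sup>2 * (2 * vol * u powr ?p)) * dirichlet_form \<mu> \<theta> \<phi> + ennreal (1 / vol\<^sup>2 * (2 * vol * M\<^sup>2 / m)) * ?L\<^sup>2"
    using vol m M0 by (simp add: distrib_left mult.assoc[symmetric] flip: ennreal_mult)
  also have "1 / vol\<^sup>2 * (2 * vol * u powr ?p) = 2 * u powr \<theta> / v"
    using vol v u by (simp add: vol_def power2_eq_square powr_add powr_realpow field_simps)
  also have "1 / vol\<^sup>2 * (2 * vol * M\<^sup>2 / m) = 2 * M\<^sup>2 / (v * u ^ DIM('a) * m)"
    using vol v u m by (simp add: vol_def power2_eq_square field_simps)
  finally show ?thesis .
qed

end

section \<open>The weak Poincare inequality\<close>

context gibbs_density
begin

lemma nn_integral_far_pairs: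
  "(\<integral>\<^sup>+x. (\<integral>\<^sup>+y\<in>{y. norm (x - y) > s}. ennreal (exp (- U x) * exp (- U y)) \<partial>lborel) \<partial>lborel)
    = (\<integral>\<^sup>+x. \<integral>\<^sup>+y. indicator {p. norm (fst p - snd p) > s} (x, y) \<partial>\<mu> \<partial>\<mu>)"
proof -
  have "(\<integral>\<^sup>+x. \<integral>\<^sup>+y. indicator {p. norm (fst p - snd p) > s} (x, y) \<partial>\<mu> \<partial>\<mu>)
     = (\<integral>\<^sup>+x. ennreal (exp (- U x)) * (\<integral>\<^sup>+y. ennreal (exp (- U y)) * indicator {p. norm (fst p - snd p) > s} (x, y) \<partial>lborel) \<partial>lborel)"
    by (simp add: nn_integral_\<mu>)
  also have "\<dots> = (\<integral>\<^sup>+x. \<integral>\<^sup>+y. ennreal (exp (- U x)) * (ennreal (exp (- U y)) * indicator {p. norm (fst p - snd p) > s} (x, y)) \<partial>lborel \<partial>lborel)"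
    by (simp add: nn_integral_cmult)
  also have "\<dots> = (\<integral>\<^sup>+x. (\<integral>\<^sup>+y\<in>{y. norm (x - y) > s}. ennreal (exp (- U x) * exp (- U y)) \<partial>lborel) \<partial>lborel)"
    by (intro nn_integral_cong) (auto simp: indicator_def ennreal_mult)
  finally show ?thesis ..
qed

lemma far_pairs_tendsto_zero:
  "(\<lambda>n. \<integral>\<^sup>+x. \<integral>\<^sup>+y. indicator {p. norm (fst p - snd p) > real n} (x, y) \<partial>\<mu> \<partial>\<mu>) \<longlonglongrightarrow> 0"
proof -
  interpret PP: pair_prob_space \<mu> \<mu> ..
  define A where "A n = {p :: 'a \<times> 'a. norm (fst p - snd p) > real n}" for n
  have sets: "A n \<in> sets (\<mu> \<Otimes>\<^sub>M \<mu>)" for n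
  proof -
    have "A n = {p \<in> space (\<mu> \<Otimes>\<^sub>M \<mu>). norm (fst p - snd p) > real n}"
      by (auto simp: A_def space_pair_measure)
    also have "\<dots> \<in> sets (\<mu> \<Otimes>\<^sub>M \<mu>)" by measurable
    finally show ?thesis .
  qed
  have "(\<lambda>n. emeasure (\<mu> \<Otimes>\<^sub>M \<mu>) (A n)) \<longlonglongrightarrow> emeasure (\<mu> \<Otimes>\<^sub>M \<mu>) (\<Inter>n. A n)"
    by (rule Lim_emeasure_decseq) (use sets in \<open>auto simp: A_def decseq_def PP.P.emeasure_eq_measure\<close>)
  moreover have "(\<Inter>n. A n) = {}"
    by (auto simp: A_def not_less) (meson not_less real_arch_simple)
  moreover have "emeasure (\<mu> \<Otimes>\<^sub>M \<mu>) (A n) = (\<integral>\<^sup>+x. \<integral>\<^sup>+y. indicator (A n) (x, y) \<partial>\<mu> \<partial>\<mu>)" for n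
    by (rule emeasure_pair_measure[OF sets])
  ultimately show ?thesis by (simp add: A_def)
qed

lemma weak_poincare_of_bounded_below:
  assumes \<theta>: "0 < \<theta>" and c: "0 < c" "\<And>x. c \<le> exp (U x)"
  shows "weak_poincare_inequality \<mu> \<theta> (weak_rate \<theta> U)"
  unfolding weak_poincare_inequality_def
proof (intro allI impI)
  fix r :: real
  assume r: "r > 0"
  let ?p = "real DIM('a) + \<theta>"
  define far where "far s = (\<integral>\<^sup>+x. \<integral>\<^sup>+y. indicator {p. norm (fst p - snd p) > s} (x, y) \<partial>\<mu> \<partial>\<mu>)" for s
  define S where "S = {s. 0 < s \<and> far s \<le> ennreal (r / 2)}"
  define I where "I s = (INF (x, y)\<in>{(x, y). 0 < norm (x - y) \<and> norm (x - y) \<le> s}.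
       ennreal ((exp (U x) + exp (U y)) * norm (x - y) powr (- ?p)))" for s
  have rate: "weak_rate \<theta> U r = (INF s\<in>S. 1 / I s)"
    unfolding weak_rate_def nn_integral_far_pairs S_def far_def I_def ..
  have I_lower: "I s \<le> ennreal ((exp (U x) + exp (U y)) * norm (x - y) powr (- ?p))"
    if "x \<noteq> y" "norm (x - y) \<le> s" for x y s
    unfolding I_def by (rule INF_lower2[of "(x, y)"]) (use that in auto)
  have I_pos: "I s > 0" if "s > 0" for s
  proof -
    have "ennreal (2 * c * s powr (- ?p)) \<le> I s"
      unfolding I_def
    proof (rule INF_greatest)
      fix p assume "p \<in> {(x, y :: 'a). 0 < norm (x - y) \<and> norm (x - y) \<le> s}"
      then obtain x y where p: "p = (x, y)" and *: "0 < norm (x - y)" "norm (x - y) \<le> s" by auto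
      have "2 * c * s powr (- ?p) \<le> (exp (U x) + exp (U y)) * norm (x - y) powr (- ?p)"
        using * \<theta> c(1) c(2)[of x] c(2)[of y] by (intro mult_mono powr_mono2') auto
      then show "ennreal (2 * c * s powr (- ?p)) \<le> (case p of (x, y) \<Rightarrow>
          ennreal ((exp (U x) + exp (U y)) * norm (x - y) powr (- ?p)))"
        unfolding p by (auto intro!: ennreal_leI)
    qed
    moreover have "0 < ennreal (2 * c * s powr (- ?p))" using c that by simp
    ultimately show ?thesis by order
  qed
  have "S \<noteq> {}"
  proof -
    have "eventually (\<lambda>n. far (real n) < ennreal (r / 2)) sequentially"
      using far_pairs_tendsto_zero r unfolding far_def by (intro order_tendstoD) auto
    then have "eventually (\<lambda>n. n > 0 \<and> far (real n) < ennreal (r / 2)) sequentially"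
      using eventually_gt_at_top[of "0::nat"] by eventually_elim auto
    then obtain n :: nat where "n > 0" "far (real n) < ennreal (r / 2)"
      using eventually_happens'[OF sequentially_bot] by blast
    then have "real n \<in> S" by (auto simp: S_def)
    then show ?thesis by auto
  qed
  show "weak_rate \<theta> U r < \<infinity> \<and> (\<forall>\<phi>\<in>dirichlet_domain \<mu> \<theta>. ennreal (variance \<phi>)
          \<le> weak_rate \<theta> U r * dirichlet_form \<mu> \<theta> \<phi> + ennreal r * (esssup \<mu> (\<lambda>x. ennreal \<bar>\<phi> x\<bar>))\<^sup>2)"
  proof (intro conjI ballI)
    obtain s where s: "s \<in> S" using \<open>S \<noteq> {}\<close> by auto
    then have "1 / I s \<noteq> \<top>"
      using I_pos[of s] by (auto simp: S_def ennreal_divide_eq_top_iff)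
    then have "1 / I s < \<top>" by (simp add: less_top)
    then show "weak_rate \<theta> U r < \<infinity>"
      unfolding rate using s by (auto simp: INF_less_iff)
  next
    fix \<phi> assume \<phi>: "\<phi> \<in> dirichlet_domain \<mu> \<theta>"
    let ?E = "dirichlet_form \<mu> \<theta> \<phi>"
    define B where "B = esssup \<mu> (\<lambda>x. ennreal \<bar>\<phi> x\<bar>)"
    note [measurable] = dirichlet_domainD(1)[OF \<phi>]
    have E: "?E < \<top>" using dirichlet_domainD(3)[OF \<phi>] .
    have "ennreal (variance \<phi>) \<le> ennreal r * B\<^sup>2 + 1 / I s * ?E" if s: "s \<in> S" for s
    proof -
      have s0: "s > 0" and far: "far s \<le> ennreal (r / 2)" using s by (auto simp: S_def)
      define far_i where "far_i x y = (indicator {p. norm (fst p - snd p) > s} (x, y) :: ennreal)" for x y :: 'a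
      define near_i where "near_i x y = (indicator {p. norm (fst p - snd p) \<le> s} (x, y) :: ennreal)" for x y :: 'a
      have [measurable]: "case_prod far_i \<in> borel_measurable (borel \<Otimes>\<^sub>M borel)"
          "case_prod near_i \<in> borel_measurable (borel \<Otimes>\<^sub>M borel)"
        unfolding far_i_def near_i_def by measurable
      define N1 where "N1 = (\<integral>\<^sup>+x. \<integral>\<^sup>+y. near_i x y * ennreal ((\<phi> x - \<phi> y)\<^sup>2) \<partial>\<mu> \<partial>\<mu>)"
      define N2 where "N2 = (\<integral>\<^sup>+x. \<integral>\<^sup>+y. far_i x y * ennreal ((\<phi> x - \<phi> y)\<^sup>2) \<partial>\<mu> \<partial>\<mu>)"
      have "ennreal (2 * variance \<phi>) = (\<integral>\<^sup>+x. \<integral>\<^sup>+y. ennreal ((\<phi> x - \<phi> y)\<^sup>2) \<partial>\<mu> \<partial>\<mu>)"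
        by (simp add: nn_integral_nn_integral_square_diff dirichlet_domainD[OF \<phi>])
      also have "\<dots> = (\<integral>\<^sup>+x. \<integral>\<^sup>+y. near_i x y * ennreal ((\<phi> x - \<phi> y)\<^sup>2) + far_i x y * ennreal ((\<phi> x - \<phi> y)\<^sup>2) \<partial>\<mu> \<partial>\<mu>)"
        by (intro nn_integral_cong) (auto simp: near_i_def far_i_def indicator_def)
      also have "\<dots> = N1 + N2"
        unfolding N1_def N2_def by (simp add: nn_integral_add)
      finally have split: "2 * ennreal (variance \<phi>) = N1 + N2" by (simp add: ennreal_mult)
      have "I s * N1 = (\<integral>\<^sup>+x. \<integral>\<^sup>+y. (I s * near_i x y) * ennreal ((\<phi> x - \<phi> y)\<^sup>2) \<partial>\<mu> \<partial>\<mu>)"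
        unfolding N1_def by (simp add: nn_integral_cmult mult.assoc)
      also have "\<dots> \<le> 2 * ?E"
      proof (rule nn_integral_kernel_le_dirichlet_form)
        fix x y :: 'a assume "x \<noteq> y"
        then show "I s * near_i x y \<le> ennreal ((exp (U x) + exp (U y)) * norm (x - y) powr (- ?p))"
          using I_lower[of x y s] by (auto simp: near_i_def indicator_def)
      qed measurable
      finally have IN: "I s * N1 \<le> 2 * ?E" .
      have N1: "N1 \<le> 1 / I s * (2 * ?E)"
      proof (cases "I s = \<top>")
        case True
        have "2 * ?E < \<top>" using E by (simp add: ennreal_mult_less_top)
        then show ?thesis using IN True by (auto simp: ennreal_top_mult top_unique split: if_splits)
      next
        case False
        have "N1 = 1 / I s * (I s * N1)"
          using I_pos[OF s0] False
          by (metis ennreal_divide_times mult.commute mult_divide_eq_ennreal mult_1 not_gr_zero)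
        also have "\<dots> \<le> 1 / I s * (2 * ?E)" by (intro mult_left_mono IN) simp
        finally show ?thesis .
      qed
      have N2: "N2 \<le> 2 * (ennreal r * B\<^sup>2)"
      proof (cases "B = \<top>")
        case True
        then show ?thesis using r by (simp add: ennreal_mult_top power2_eq_square)
      next
        case False
        then obtain b where b: "B = ennreal b" "b \<ge> 0" by (metis ennreal_cases)
        have AE: "AE x in \<mu>. \<bar>\<phi> x\<bar> \<le> b"
          using esssup_AE[of "\<lambda>x. ennreal \<bar>\<phi> x\<bar>" \<mu>] b unfolding B_def[symmetric] by simp
        have "N2 \<le> (\<integral>\<^sup>+x. \<integral>\<^sup>+y. far_i x y * ennreal (4 * b\<^sup>2) \<partial>\<mu> \<partial>\<mu>)"
          unfolding N2_def
        proof (intro nn_integral_mono_AE)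
          show "AE x in \<mu>. (\<integral>\<^sup>+y. far_i x y * ennreal ((\<phi> x - \<phi> y)\<^sup>2) \<partial>\<mu>) \<le> (\<integral>\<^sup>+y. far_i x y * ennreal (4 * b\<^sup>2) \<partial>\<mu>)"
            using AE
          proof eventually_elim
            case (elim x)
            show ?case
            proof (intro nn_integral_mono_AE)
              show "AE y in \<mu>. far_i x y * ennreal ((\<phi> x - \<phi> y)\<^sup>2) \<le> far_i x y * ennreal (4 * b\<^sup>2)"
                using AE
              proof eventually_elim
                case (elim y)
                have "\<bar>\<phi> x - \<phi> y\<bar> \<le> 2 * b" using elim \<open>\<bar>\<phi> x\<bar> \<le> b\<close> by linarith
                then have "(\<phi> x - \<phi> y)\<^sup>2 \<le> (2 * b)\<^sup>2" by (metis abs_ge_zero power2_abs power_mono)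
                then show ?case by (intro mult_left_mono ennreal_leI) (auto simp: power_mult_distrib)
              qed
            qed
          qed
        qed
        also have "\<dots> = ennreal (4 * b\<^sup>2) * far s"
          unfolding far_def far_i_def[symmetric] by (simp add: nn_integral_multc mult.commute)
        also have "\<dots> \<le> ennreal (4 * b\<^sup>2) * ennreal (r / 2)"
          by (intro mult_left_mono far) simp
        also have "\<dots> = 2 * (ennreal r * B\<^sup>2)"
          using r b by (simp add: ennreal_power flip: ennreal_mult ennreal_numeral)
        finally show ?thesis .
      qed
      have "2 * ennreal (variance \<phi>) \<le> 1 / I s * (2 * ?E) + 2 * (ennreal r * B\<^sup>2)"
        unfolding split by (intro add_mono N1 N2)
      also have "\<dots> = 2 * (ennreal r * B\<^sup>2 + 1 / I s * ?E)"
        by (simp add: distrib_left ac_simps)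
      finally show ?thesis
        by (subst (asm) ennreal_mult_le_mult_iff) auto
    qed
    then have "ennreal (variance \<phi>) \<le> ennreal r * B\<^sup>2 + (INF s\<in>S. 1 / I s) * ?E"
      using \<open>S \<noteq> {}\<close> E by (intro le_INF_mult_add)
    then show "ennreal (variance \<phi>) \<le> weak_rate \<theta> U r * ?E + ennreal r * (esssup \<mu> (\<lambda>x. ennreal \<bar>\<phi> x\<bar>))\<^sup>2"
      by (simp add: rate B_def add.commute)
  qed
qed

end

section \<open>The super Poincare inequality\<close>

lemma local_super_rate_eq:
  fixes V :: "'a::euclidean_space \<Rightarrow> real"
  assumes V: "continuous_on UNIV V" and "0 < t"
  obtains z\<^sub>0 z\<^sub>1 where
    "\<And>z. norm z \<le> 2 * t \<Longrightarrow> V z \<le> V z\<^sub>0"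
    "\<And>z. norm z \<le> t \<Longrightarrow> V z\<^sub>1 \<le> V z"
    "\<And>s. 0 < s \<Longrightarrow> local_super_rate \<theta> V t s
       = (INF u\<in>{u. 0 < u \<and> u powr \<theta> * exp (V z\<^sub>0) / exp (V z\<^sub>1) \<le> s}.
            ennreal ((exp (V z\<^sub>0))\<^sup>2 / (u ^ DIM('a) * exp (V z\<^sub>1))))"
proof -
  have "compact (cball (0 :: 'a) (2 * t))" "cball (0 :: 'a) (2 * t) \<noteq> {}"
    "continuous_on (cball 0 (2 * t)) V"
    using \<open>0 < t\<close> continuous_on_subset[OF V] by auto
  from continuous_attains_sup[OF this] obtain z\<^sub>0 where z\<^sub>0: "norm z\<^sub>0 \<le> 2 * t"
    "\<And>z. norm z \<le> 2 * t \<Longrightarrow> V z \<le> V z\<^sub>0" by auto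
  have "compact (cball (0 :: 'a) t)" "cball (0 :: 'a) t \<noteq> {}" "continuous_on (cball 0 t) V"
    using \<open>0 < t\<close> continuous_on_subset[OF V] by auto
  from continuous_attains_inf[OF this] obtain z\<^sub>1 where z\<^sub>1: "norm z\<^sub>1 \<le> t"
    "\<And>z. norm z \<le> t \<Longrightarrow> V z\<^sub>1 \<le> V z" by auto
  have sup: "(SUP z\<in>{z. norm z \<le> 2 * t}. ennreal (exp (V z))) = ennreal (exp (V z\<^sub>0))"
    using z\<^sub>0 by (intro antisym SUP_least SUP_upper) (auto intro!: ennreal_leI)
  have inf: "(INF z\<in>{z. norm z \<le> t}. ennreal (exp (V z))) = ennreal (exp (V z\<^sub>1))"
    using z\<^sub>1 by (intro antisym INF_greatest INF_lower) (auto intro!: ennreal_leI)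
  have "local_super_rate \<theta> V t s
       = (INF u\<in>{u. 0 < u \<and> u powr \<theta> * exp (V z\<^sub>0) / exp (V z\<^sub>1) \<le> s}.
            ennreal ((exp (V z\<^sub>0))\<^sup>2 / (u ^ DIM('a) * exp (V z\<^sub>1))))" if "0 < s" for s
    unfolding local_super_rate_def sup inf Let_def using that
    by (intro INF_cong) (auto simp: divide_ennreal ennreal_power simp flip: ennreal_mult)
  with z\<^sub>0(2) z\<^sub>1(2) show ?thesis by (rule that)
qed

context gibbs_density
begin

lemma nn_integral_weight_square_le:
  fixes \<omega> :: "'a \<Rightarrow> real"
  assumes \<phi>: "\<phi> \<in> dirichlet_domain \<mu> \<theta>" and [measurable]: "\<omega> \<in> borel_measurable borel"
    and \<omega>: "\<And>x. 0 \<le> \<omega> x" "\<And>x y. x \<noteq> y \<Longrightarrow>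
      2 * \<omega> x \<le> (exp (U x) + exp (U y)) * norm (x - y) powr (- (real DIM('a) + \<theta>))"
  shows "(\<integral>\<^sup>+x. ennreal (\<omega> x) * ennreal ((\<phi> x)\<^sup>2) \<partial>\<mu>)
    \<le> 2 * dirichlet_form \<mu> \<theta> \<phi> + 2 * (\<integral>\<^sup>+x. ennreal (\<omega> x) \<partial>\<mu>) * (\<integral>\<^sup>+x. ennreal \<bar>\<phi> x\<bar> \<partial>\<mu>)\<^sup>2"
proof -
  note [measurable] = dirichlet_domainD(1)[OF \<phi>]
  let ?m = "expectation \<phi>" and ?L = "\<integral>\<^sup>+x. ennreal \<bar>\<phi> x\<bar> \<partial>\<mu>"
  have "integrable \<mu> \<phi>"
    by (rule square_integrable_imp_integrable) (use dirichlet_domainD[OF \<phi>] in auto)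
  then have "ennreal \<bar>?m\<bar> \<le> ?L"
    using integral_norm_bound_ennreal[of \<mu> \<phi>] by simp
  then have "(ennreal \<bar>?m\<bar>)\<^sup>2 \<le> ?L\<^sup>2" by (rule power_mono) simp
  then have mean: "ennreal (?m\<^sup>2) \<le> ?L\<^sup>2" by (simp add: ennreal_power)
  have "(\<integral>\<^sup>+x. ennreal (\<omega> x) * ennreal ((\<phi> x)\<^sup>2) \<partial>\<mu>)
      \<le> (\<integral>\<^sup>+x. 2 * (ennreal (\<omega> x) * ennreal ((\<phi> x - ?m)\<^sup>2)) + 2 * ennreal (?m\<^sup>2) * ennreal (\<omega> x) \<partial>\<mu>)"
  proof (intro nn_integral_mono)
    fix x
    have "0 \<le> (\<phi> x - 2 * ?m)\<^sup>2" by simp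
    then have "(\<phi> x)\<^sup>2 \<le> 2 * (\<phi> x - ?m)\<^sup>2 + 2 * ?m\<^sup>2"
      by (simp add: power2_eq_square algebra_simps)
    then have "\<omega> x * (\<phi> x)\<^sup>2 \<le> \<omega> x * (2 * (\<phi> x - ?m)\<^sup>2 + 2 * ?m\<^sup>2)"
      by (rule mult_left_mono) (rule \<omega>)
    then have "\<omega> x * (\<phi> x)\<^sup>2 \<le> 2 * (\<omega> x * (\<phi> x - ?m)\<^sup>2) + 2 * ?m\<^sup>2 * \<omega> x"
      by (simp add: algebra_simps)
    then show "ennreal (\<omega> x) * ennreal ((\<phi> x)\<^sup>2)
      \<le> 2 * (ennreal (\<omega> x) * ennreal ((\<phi> x - ?m)\<^sup>2)) + 2 * ennreal (?m\<^sup>2) * ennreal (\<omega> x)"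
      using \<omega>(1)[of x] by (simp add: ennreal_leI flip: ennreal_mult ennreal_plus ennreal_numeral)
  qed
  also have "\<dots> = 2 * (\<integral>\<^sup>+x. ennreal (\<omega> x) * ennreal ((\<phi> x - ?m)\<^sup>2) \<partial>\<mu>)
      + 2 * ennreal (?m\<^sup>2) * (\<integral>\<^sup>+x. ennreal (\<omega> x) \<partial>\<mu>)"
    by (simp add: nn_integral_add nn_integral_cmult)
  also have "\<dots> \<le> 2 * dirichlet_form \<mu> \<theta> \<phi> + 2 * ?L\<^sup>2 * (\<integral>\<^sup>+x. ennreal (\<omega> x) \<partial>\<mu>)"
    by (intro add_mono mult_left_mono mult_right_mono weighted_poincare[OF \<phi> _ \<omega>] mean) auto
  finally show ?thesis by (simp add: ac_simps)
qed

lemma nn_integral_superlevel_square_le: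
  fixes \<omega> :: "'a \<Rightarrow> real"
  assumes \<phi>: "\<phi> \<in> dirichlet_domain \<mu> \<theta>" and [measurable]: "\<omega> \<in> borel_measurable borel" "A \<in> sets borel"
    and \<omega>: "\<And>x. 0 \<le> \<omega> x" "\<And>x y. x \<noteq> y \<Longrightarrow>
      2 * \<omega> x \<le> (exp (U x) + exp (U y)) * norm (x - y) powr (- (real DIM('a) + \<theta>))"
    and W: "0 < W" "\<And>x. x \<in> A \<Longrightarrow> W \<le> \<omega> x"
  shows "(\<integral>\<^sup>+x. ennreal ((\<phi> x)\<^sup>2) * indicator A x \<partial>\<mu>)
    \<le> 2 / ennreal W * dirichlet_form \<mu> \<theta> \<phi>
      + 2 * (\<integral>\<^sup>+x. ennreal (\<omega> x) \<partial>\<mu>) / ennreal W * (\<integral>\<^sup>+x. ennreal \<bar>\<phi> x\<bar> \<partial>\<mu>)\<^sup>2"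
proof -
  note [measurable] = dirichlet_domainD(1)[OF \<phi>]
  let ?N = "\<integral>\<^sup>+x. ennreal ((\<phi> x)\<^sup>2) * indicator A x \<partial>\<mu>"
  have "ennreal W * ?N = (\<integral>\<^sup>+x. ennreal W * (ennreal ((\<phi> x)\<^sup>2) * indicator A x) \<partial>\<mu>)"
    by (rule nn_integral_cmult[symmetric]) simp
  also have "\<dots> \<le> (\<integral>\<^sup>+x. ennreal (\<omega> x) * ennreal ((\<phi> x)\<^sup>2) \<partial>\<mu>)"
    by (intro nn_integral_mono) (auto simp: indicator_def intro!: mult_right_mono ennreal_leI W)
  also note nn_integral_weight_square_le[OF \<phi> assms(2) \<omega>]
  finally have "ennreal W * ?N / ennreal W \<le> (2 * dirichlet_form \<mu> \<theta> \<phi>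
      + 2 * (\<integral>\<^sup>+x. ennreal (\<omega> x) \<partial>\<mu>) * (\<integral>\<^sup>+x. ennreal \<bar>\<phi> x\<bar> \<partial>\<mu>)\<^sup>2) / ennreal W"
    by (rule divide_right_mono_ennreal)
  moreover have "ennreal W * ?N / ennreal W = ?N"
    using W by (simp add: mult.commute[of "ennreal W"] ennreal_mult_divide_eq)
  ultimately show ?thesis
    by (simp add: add_divide_distrib_ennreal ennreal_divide_times ennreal_times_divide mult.commute)
qed

text \<open>The local rate contains neither the volume of the unit ball nor the normalization constant, so
  for a radius \<^term>\<open>u\<close> in its index set the local estimate is applied with radius \<^term>\<open>\<kappa> * u\<close>.
  This is affordable because the oscillation of \<^term>\<open>exp \<circ> V\<close> on a ball of radius \<^term>\<open>t\<close> grows faster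
  than \<^term>\<open>t\<close>. For small \<^term>\<open>t\<close> the local estimate may fail, but there the weight is at least
  its infimum over \<^term>\<open>norm x \<ge> t\<close> on the whole space, and no localization is needed.\<close>

lemma super_poincare_of_weight:
  fixes V :: "'a \<Rightarrow> real" and P :: "real \<Rightarrow> real"
  defines "v \<equiv> unit_ball_vol (real DIM('a))"
  assumes \<theta>: "0 < \<theta>" and Z: "0 < Z" and U_eq: "\<And>x. U x = V x + ln Z" and gibbs: "gibbs V = \<mu>"
    and R: "1 < R"
    and P_mono: "\<And>x y. R \<le> x \<Longrightarrow> x \<le> y \<Longrightarrow> P x \<le> P y" and P_pos: "\<And>x. R \<le> x \<Longrightarrow> 0 < P x"
    and P_lim: "filterlim P at_top at_top"
    and \<omega>_def: "\<And>x. \<omega> x = P (max R (norm x))" and \<omega>_meas [measurable]: "\<omega> \<in> borel_measurable borel"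
    and \<omega>_le: "\<And>x y. x \<noteq> y \<Longrightarrow>
      2 * \<omega> x \<le> (exp (U x) + exp (U y)) * norm (x - y) powr (- (real DIM('a) + \<theta>))"
    and \<omega>_int: "(\<integral>\<^sup>+x. ennreal (\<omega> x) \<partial>\<mu>) < \<top>"
    and \<kappa>: "1 \<le> \<kappa>" "2 * Z / v \<le> \<kappa>"
    and growth: "\<And>t. R \<le> t \<Longrightarrow> \<exists>z z'. norm z \<le> 2 * t \<and> norm z' \<le> t \<and>
      \<kappa> powr \<theta> * max 1 (2 / v) * t * exp (V z') \<le> exp (V z)"
  shows "super_poincare_inequality \<mu> \<theta> (super_rate \<theta> V \<omega>)"
  unfolding super_poincare_inequality_def
proof (intro allI impI)
  fix r :: real
  assume r: "r > 0"
  define \<mu>\<omega> where "\<mu>\<omega> = (\<integral>\<^sup>+x. ennreal (\<omega> x) \<partial>\<mu>)"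
  have \<omega>_nonneg: "0 \<le> \<omega> x" for x using P_pos[of "max R (norm x)"] by (simp add: \<omega>_def)
  have v: "v > 0" by (simp add: v_def)
  have V_cont: "continuous_on UNIV V"
    using continuous_on_diff[OF continuous continuous_on_const[of _ "ln Z"]] U_eq by simp
  define T where "T = {(t, s). 0 < t \<and> 0 < s \<and> 2 / ennreal (P (max R t)) + ennreal s \<le> ennreal r}"
  have inf: "(INF x\<in>{x::'a. norm x \<ge> t}. ennreal (\<omega> x)) = ennreal (P (max R t))" if t: "t > 0" for t
  proof (rule antisym)
    obtain x :: 'a where "norm x = t" by (rule vector_choose_size[OF less_imp_le[OF t]])
    then show "(INF x\<in>{x::'a. norm x \<ge> t}. ennreal (\<omega> x)) \<le> ennreal (P (max R t))"
      by (intro INF_lower2[of x]) (auto simp: \<omega>_def)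
    show "ennreal (P (max R t)) \<le> (INF x\<in>{x::'a. norm x \<ge> t}. ennreal (\<omega> x))"
      by (intro INF_greatest ennreal_leI) (auto simp: \<omega>_def intro!: P_mono)
  qed
  have rate: "super_rate \<theta> V \<omega> r = (INF (t, s)\<in>T. 2 * \<mu>\<omega> / ennreal (P (max R t)) + local_super_rate \<theta> V t (min t s))"
    unfolding super_rate_def Let_def T_def gibbs \<mu>\<omega>_def
    by (intro INF_cong) (auto simp: inf)
  have "\<exists>t. t \<ge> R \<and> P t \<ge> 4 / r"
    using eventually_conj[OF eventually_ge_at_top[of R] P_lim[unfolded filterlim_at_top, rule_format, of "4 / r"]]
    by (rule eventually_happens'[rotated]) simp
  then obtain t\<^sub>0 where t\<^sub>0: "t\<^sub>0 \<ge> R" "P t\<^sub>0 \<ge> 4 / r" by auto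
  have "(t\<^sub>0, r / 2) \<in> T"
  proof -
    have "2 / P t\<^sub>0 + r / 2 \<le> r"
      using t\<^sub>0 r P_pos[OF t\<^sub>0(1)] by (simp add: field_simps)
    then have "2 / ennreal (P t\<^sub>0) + ennreal (r / 2) \<le> ennreal r"
      using r P_pos[OF t\<^sub>0(1)] by (simp add: divide_ennreal ennreal_leI flip: ennreal_numeral ennreal_plus)
    then show ?thesis using t\<^sub>0 R r by (simp add: T_def max_absorb2)
  qed
  have ex_radius: "\<exists>u. 0 < u \<and> u powr \<theta> * a / b \<le> s" if "0 < a" "0 < b" "0 < s" for a b s :: real
  proof (intro exI conjI)
    show "0 < (s * b / a) powr (1 / \<theta>)" using that by simp
    show "((s * b / a) powr (1 / \<theta>)) powr \<theta> * a / b \<le> s"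
      using that \<theta> by (simp add: powr_powr)
  qed
  show "super_rate \<theta> V \<omega> r < \<infinity> \<and> (\<forall>\<phi>\<in>dirichlet_domain \<mu> \<theta>.
          (\<integral>\<^sup>+x. ennreal ((\<phi> x)\<^sup>2) \<partial>\<mu>)
            \<le> ennreal r * dirichlet_form \<mu> \<theta> \<phi> + super_rate \<theta> V \<omega> r * (\<integral>\<^sup>+x. ennreal \<bar>\<phi> x\<bar> \<partial>\<mu>)\<^sup>2)"
  proof (intro conjI ballI)
    have t\<^sub>0': "0 < t\<^sub>0" "0 < min t\<^sub>0 (r / 2)" using t\<^sub>0 R r by auto
    obtain z\<^sub>0 z\<^sub>1 where "\<And>z. norm z \<le> 2 * t\<^sub>0 \<Longrightarrow> V z \<le> V z\<^sub>0"
      "\<And>z. norm z \<le> t\<^sub>0 \<Longrightarrow> V z\<^sub>1 \<le> V z"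
      and "\<And>s. 0 < s \<Longrightarrow> local_super_rate \<theta> V t\<^sub>0 s
       = (INF u\<in>{u. 0 < u \<and> u powr \<theta> * exp (V z\<^sub>0) / exp (V z\<^sub>1) \<le> s}.
            ennreal ((exp (V z\<^sub>0))\<^sup>2 / (u ^ DIM('a) * exp (V z\<^sub>1))))"
      by (rule local_super_rate_eq[OF V_cont t\<^sub>0'(1), of \<theta>]) (rule that)
    note eq = this(3)[OF t\<^sub>0'(2)]
    obtain u where "0 < u" "u powr \<theta> * exp (V z\<^sub>0) / exp (V z\<^sub>1) \<le> min t\<^sub>0 (r / 2)"
      using ex_radius[OF exp_gt_zero exp_gt_zero t\<^sub>0'(2)] by metis
    then have "u \<in> {u. 0 < u \<and> u powr \<theta> * exp (V z\<^sub>0) / exp (V z\<^sub>1) \<le> min t\<^sub>0 (r / 2)}" by blast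
    then have "local_super_rate \<theta> V t\<^sub>0 (min t\<^sub>0 (r / 2)) < \<top>"
      unfolding eq INF_less_iff by (rule bexI[rotated]) simp
    moreover have "2 * \<mu>\<omega> / ennreal (P (max R t\<^sub>0)) < \<top>"
      using \<omega>_int P_pos[of "max R t\<^sub>0"]
      by (auto simp: \<mu>\<omega>_def less_top[symmetric] ennreal_divide_eq_top_iff ennreal_mult_eq_top_iff)
    ultimately have "2 * \<mu>\<omega> / ennreal (P (max R t\<^sub>0)) + local_super_rate \<theta> V t\<^sub>0 (min t\<^sub>0 (r / 2)) < \<top>"
      by simp
    then show "super_rate \<theta> V \<omega> r < \<infinity>"
      unfolding rate INF_less_iff using \<open>(t\<^sub>0, r / 2) \<in> T\<close> by (intro bexI[of _ "(t\<^sub>0, r / 2)"]) auto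
  next
    fix \<phi> assume \<phi>: "\<phi> \<in> dirichlet_domain \<mu> \<theta>"
    note [measurable] = dirichlet_domainD(1)[OF \<phi>]
    let ?E = "dirichlet_form \<mu> \<theta> \<phi>" and ?L = "\<integral>\<^sup>+x. ennreal \<bar>\<phi> x\<bar> \<partial>\<mu>"
    let ?N = "\<integral>\<^sup>+x. ennreal ((\<phi> x)\<^sup>2) \<partial>\<mu>"
    have "integrable \<mu> \<phi>"
      by (rule square_integrable_imp_integrable) (use dirichlet_domainD[OF \<phi>] in auto)
    then have "?L < \<top>" by (simp add: integrable_iff_bounded)
    then have L: "?L\<^sup>2 < \<top>" by (simp add: power_less_top_ennreal)
    have main: "?N \<le> ennreal r * ?E + (2 * \<mu>\<omega> / ennreal (P (max R t)) + local_super_rate \<theta> V t (min t s)) * ?L\<^sup>2"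
      if "(t, s) \<in> T" for t s
    proof -
      have ts: "0 < t" "0 < s" and rs: "2 / ennreal (P (max R t)) + ennreal s \<le> ennreal r"
        using that by (auto simp: T_def)
      define W where "W = P (max R t)"
      have W: "0 < W" by (simp add: W_def P_pos)
      have superlevel: "(\<integral>\<^sup>+x. ennreal ((\<phi> x)\<^sup>2) * indicator A x \<partial>\<mu>)
           \<le> 2 / ennreal W * ?E + 2 * \<mu>\<omega> / ennreal W * ?L\<^sup>2"
        if "A \<in> sets borel" "\<And>x. x \<in> A \<Longrightarrow> W \<le> \<omega> x" for A
        unfolding \<mu>\<omega>_def by (rule nn_integral_superlevel_square_le[OF \<phi> \<omega>_meas that(1) \<omega>_nonneg \<omega>_le W that(2)])
      show ?thesis
      proof (cases "t \<le> R")
        case True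
        then have "?N \<le> 2 / ennreal W * ?E + 2 * \<mu>\<omega> / ennreal W * ?L\<^sup>2"
          using superlevel[of UNIV] by (simp add: W_def \<omega>_def P_mono max_absorb1)
        also have "\<dots> \<le> ennreal r * ?E + (2 * \<mu>\<omega> / ennreal W + local_super_rate \<theta> V t (min t s)) * ?L\<^sup>2"
          using rs by (intro add_mono mult_right_mono) (auto simp: W_def intro: order_trans[rotated])
        finally show ?thesis by (simp add: W_def)
      next
        case False
        then have t: "R \<le> t" "1 < t" using R by auto
        obtain z\<^sub>0 z\<^sub>1 where z\<^sub>0: "\<And>z. norm z \<le> 2 * t \<Longrightarrow> V z \<le> V z\<^sub>0"
          and z\<^sub>1: "\<And>z. norm z \<le> t \<Longrightarrow> V z\<^sub>1 \<le> V z"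
          and "\<And>s. 0 < s \<Longrightarrow> local_super_rate \<theta> V t s
             = (INF u\<in>{u. 0 < u \<and> u powr \<theta> * exp (V z\<^sub>0) / exp (V z\<^sub>1) \<le> s}.
                  ennreal ((exp (V z\<^sub>0))\<^sup>2 / (u ^ DIM('a) * exp (V z\<^sub>1))))"
          by (rule local_super_rate_eq[OF V_cont ts(1), of \<theta>]) (rule that)
        note eq = this(3)[of "min t s"]
        have min_ts: "0 < min t s" using ts by simp
        define M m where "M = exp (V z\<^sub>0)" and "m = exp (V z\<^sub>1)"
        have Mm: "M > 0" "m > 0" by (auto simp: M_def m_def)
        have ratio: "\<kappa> powr \<theta> * max 1 (2 / v) * t \<le> M / m"
        proof -
          obtain z z' where z: "norm z \<le> 2 * t" "norm z' \<le> t"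
            "\<kappa> powr \<theta> * max 1 (2 / v) * t * exp (V z') \<le> exp (V z)" using growth[OF t(1)] by auto
          have "\<kappa> powr \<theta> * max 1 (2 / v) * t * m \<le> \<kappa> powr \<theta> * max 1 (2 / v) * t * exp (V z')"
            unfolding m_def using z\<^sub>1[OF z(2)] t by (intro mult_left_mono) auto
          also have "\<dots> \<le> exp (V z)" by (rule z)
          also have "\<dots> \<le> M" unfolding M_def using z\<^sub>0[OF z(1)] by simp
          finally show ?thesis using Mm by (simp add: field_simps)
        qed
        have \<kappa>0: "\<kappa> powr \<theta> > 0" using \<kappa> by simp
        have inner: "?N \<le> (ennreal r * ?E + 2 * \<mu>\<omega> / ennreal W * ?L\<^sup>2)
            + ennreal (M\<^sup>2 / (u ^ DIM('a) * m)) * ?L\<^sup>2"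
          if u: "0 < u" "u powr \<theta> * M / m \<le> min t s" for u
        proof -
          have u1: "\<kappa> powr \<theta> * max 1 (2 / v) * t * u powr \<theta> \<le> min t s"
          proof -
            have "\<kappa> powr \<theta> * max 1 (2 / v) * t * u powr \<theta> \<le> M / m * u powr \<theta>"
              by (intro mult_right_mono ratio) simp
            then show ?thesis using u by (simp add: mult.commute)
          qed
          have \<kappa>u: "(\<kappa> * u) powr \<theta> = \<kappa> powr \<theta> * u powr \<theta>" using \<kappa> u by (simp add: powr_mult)
          have small: "max 1 (2 / v) * t * (\<kappa> * u) powr \<theta> \<le> min t s"
            using u1 by (simp add: \<kappa>u mult_ac)
          have "1 * t * (\<kappa> * u) powr \<theta> \<le> max 1 (2 / v) * t * (\<kappa> * u) powr \<theta>"
            using t by (intro mult_right_mono) auto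
          then have "t * (\<kappa> * u) powr \<theta> \<le> t * 1" using small by simp
          then have "(\<kappa> * u) powr \<theta> \<le> 1 powr \<theta>" using t by simp
          then have "\<kappa> * u \<le> 1"
            using powr_less_mono2[of \<theta> 1 "\<kappa> * u"] \<theta> by (meson linorder_not_le zero_le_one)
          then have le_t: "\<kappa> * u \<le> t" using t by simp
          have "2 / v * 1 * (\<kappa> * u) powr \<theta> \<le> max 1 (2 / v) * t * (\<kappa> * u) powr \<theta>"
            using t v by (intro mult_right_mono mult_mono) auto
          then have le_s: "2 * (\<kappa> * u) powr \<theta> / v \<le> s" using small by simp
          have expU: "exp (U x) = Z * exp (V x)" for x using Z by (simp add: U_eq exp_add)
          have "(\<integral>\<^sup>+x. ennreal ((\<phi> x)\<^sup>2) * indicator (cball 0 t) x \<partial>\<mu>)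
            \<le> ennreal (2 * (\<kappa> * u) powr \<theta> / v) * ?E
              + ennreal (2 * (Z * M)\<^sup>2 / (v * (\<kappa> * u) ^ DIM('a) * (Z * m))) * ?L\<^sup>2"
            unfolding v_def
            by (rule nn_integral_cball_square_le)
              (use \<kappa> u le_t \<theta> Z Mm z\<^sub>0 z\<^sub>1 in \<open>auto simp: expU M_def m_def intro!: mult_pos_pos\<close>)
          also have "\<dots> \<le> ennreal s * ?E + ennreal (M\<^sup>2 / (u ^ DIM('a) * m)) * ?L\<^sup>2"
          proof (intro add_mono mult_right_mono ennreal_leI)
            have "2 * Z / v \<le> \<kappa> ^ DIM('a)"
              using \<kappa> self_le_power[of \<kappa> "DIM('a)"] DIM_positive[where 'a='a] by linarith
            then have "2 * Z / (v * \<kappa> ^ DIM('a)) \<le> 1"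
              using v \<kappa> by (simp add: field_simps)
            then have "2 * Z / (v * \<kappa> ^ DIM('a)) * (M\<^sup>2 / (u ^ DIM('a) * m)) \<le> 1 * (M\<^sup>2 / (u ^ DIM('a) * m))"
              using Mm u by (intro mult_right_mono) auto
            then show "2 * (Z * M)\<^sup>2 / (v * (\<kappa> * u) ^ DIM('a) * (Z * m)) \<le> M\<^sup>2 / (u ^ DIM('a) * m)"
              using Z by (simp add: power_mult_distrib power2_eq_square[of Z] mult_ac)
          qed (use le_s in auto)
          finally have inside: "(\<integral>\<^sup>+x. ennreal ((\<phi> x)\<^sup>2) * indicator (cball 0 t) x \<partial>\<mu>)
            \<le> ennreal s * ?E + ennreal (M\<^sup>2 / (u ^ DIM('a) * m)) * ?L\<^sup>2" .
          have [measurable]: "cball (0 :: 'a) t \<in> sets borel" "- cball (0 :: 'a) t \<in> sets borel"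
            by simp_all
          have outside: "(\<integral>\<^sup>+x. ennreal ((\<phi> x)\<^sup>2) * indicator (- cball 0 t) x \<partial>\<mu>)
              \<le> 2 / ennreal W * ?E + 2 * \<mu>\<omega> / ennreal W * ?L\<^sup>2"
            by (rule superlevel) (use t in \<open>auto simp: W_def \<omega>_def intro!: P_mono\<close>)
          have "?N = (\<integral>\<^sup>+x. ennreal ((\<phi> x)\<^sup>2) * indicator (cball 0 t) x
              + ennreal ((\<phi> x)\<^sup>2) * indicator (- cball 0 t) x \<partial>\<mu>)"
            by (intro nn_integral_cong) (auto simp: indicator_def)
          also have "\<dots> = (\<integral>\<^sup>+x. ennreal ((\<phi> x)\<^sup>2) * indicator (cball 0 t) x \<partial>\<mu>)
              + (\<integral>\<^sup>+x. ennreal ((\<phi> x)\<^sup>2) * indicator (- cball 0 t) x \<partial>\<mu>)"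
            by (rule nn_integral_add) measurable
          also have "\<dots> \<le> (ennreal s * ?E + ennreal (M\<^sup>2 / (u ^ DIM('a) * m)) * ?L\<^sup>2)
              + (2 / ennreal W * ?E + 2 * \<mu>\<omega> / ennreal W * ?L\<^sup>2)"
            by (intro add_mono inside outside)
          also have "\<dots> = (2 / ennreal W + ennreal s) * ?E + 2 * \<mu>\<omega> / ennreal W * ?L\<^sup>2
              + ennreal (M\<^sup>2 / (u ^ DIM('a) * m)) * ?L\<^sup>2"
            unfolding distrib_right by (simp only: ac_simps)
          also have "\<dots> \<le> ennreal r * ?E + 2 * \<mu>\<omega> / ennreal W * ?L\<^sup>2
              + ennreal (M\<^sup>2 / (u ^ DIM('a) * m)) * ?L\<^sup>2"
            using rs by (intro add_right_mono mult_right_mono) (auto simp: W_def)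
          finally show ?thesis .
        qed
        have "?N \<le> (ennreal r * ?E + 2 * \<mu>\<omega> / ennreal W * ?L\<^sup>2) + local_super_rate \<theta> V t (min t s) * ?L\<^sup>2"
          unfolding eq[OF min_ts] M_def[symmetric] m_def[symmetric]
        proof (rule le_INF_mult_add[OF _ L])
          show "{u. 0 < u \<and> u powr \<theta> * M / m \<le> min t s} \<noteq> {}"
            using ex_radius[OF Mm min_ts] by blast
        qed (simp only: mem_Collect_eq inner)
        then show ?thesis by (simp add: W_def distrib_right add.assoc)
      qed
    qed
    have "?N \<le> ennreal r * ?E + (INF p\<in>T. case p of (t, s) \<Rightarrow>
        2 * \<mu>\<omega> / ennreal (P (max R t)) + local_super_rate \<theta> V t (min t s)) * ?L\<^sup>2"
      using \<open>(t\<^sub>0, r / 2) \<in> T\<close> main by (intro le_INF_mult_add[OF _ L]) auto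
    then show "?N \<le> ennreal r * ?E + super_rate \<theta> V \<omega> r * ?L\<^sup>2"
      by (simp add: rate)
  qed
qed

end

section \<open>Growth of the potential\<close>

lemma exp_ge_of_radial_convexity:
  fixes f f' \<psi> :: "real \<Rightarrow> real" and b \<beta> \<rho> d N :: real
  assumes \<beta>: "0 < \<beta>" and b: "0 < b"
    and \<psi>: "\<And>r. b powr (- 1 / \<beta>) \<le> r \<Longrightarrow> \<psi> r = exp (b * r powr \<beta>)"
    and f': "\<And>r. (f has_real_derivative f' r) (at r)"
    and conv: "\<And>r. N < r \<Longrightarrow> \<rho> < f' (\<psi> r) * deriv \<psi> r * r powr (- 1)
            - b * \<beta> * d * r powr (\<beta> - 2) + (d - \<beta>) * r powr (- 2)"
  obtains K R where "0 < K" "1 < R"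
    "\<And>x. R \<le> x \<Longrightarrow> K * x powr (d + 1 / 2 * \<rho> * b powr (- 2 / \<beta>) * ln x powr (2 / \<beta> - 1))
        * ln x powr (- (d - \<beta>) / \<beta>) \<le> exp (f x)"
proof -
  define r\<^sub>0 where "r\<^sub>0 = max N (b powr (- 1 / \<beta>)) + 1"
  have r\<^sub>0: "N < r\<^sub>0" "b powr (- 1 / \<beta>) < r\<^sub>0" by (auto simp: r\<^sub>0_def)
  then have r\<^sub>0_pos: "0 < r\<^sub>0" using powr_ge_zero[of b "- 1 / \<beta>"] by linarith
  define h where "h r = f (exp (b * r powr \<beta>)) - d * (b * r powr \<beta>) + (d - \<beta>) * ln r - \<rho> / 2 * r\<^sup>2" for r
  have h_mono: "h r\<^sub>0 \<le> h s" if "r\<^sub>0 \<le> s" for s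
  proof (rule DERIV_nonneg_imp_nondecreasing[OF that])
    fix r assume "r\<^sub>0 \<le> r" "r \<le> s"
    then have r: "0 < r" "N < r" "b powr (- 1 / \<beta>) < r" using r\<^sub>0 r\<^sub>0_pos by auto
    let ?e = "exp (b * r powr \<beta>)"
    have d_exp: "((\<lambda>r. exp (b * r powr \<beta>)) has_real_derivative ?e * (b * (\<beta> * r powr (\<beta> - 1)))) (at r)"
      using r by (auto intro!: derivative_eq_intros)
    have "(\<psi> has_real_derivative ?e * (b * (\<beta> * r powr (\<beta> - 1)))) (at r)"
      by (rule has_field_derivative_transform_within_open[OF d_exp, of "{b powr (- 1 / \<beta>)<..}"])
        (use r \<psi> in auto)
    then have deriv_\<psi>: "deriv \<psi> r = ?e * (b * (\<beta> * r powr (\<beta> - 1)))" by (rule DERIV_imp_deriv)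
    have "((\<lambda>r. f (exp (b * r powr \<beta>))) has_real_derivative f' ?e * (?e * (b * (\<beta> * r powr (\<beta> - 1))))) (at r)"
      by (rule DERIV_chain2[OF f' d_exp])
    then have deriv_h: "(h has_real_derivative f' ?e * (?e * (b * (\<beta> * r powr (\<beta> - 1))))
        - d * (b * (\<beta> * r powr (\<beta> - 1))) + (d - \<beta>) / r - \<rho> * r) (at r)"
      unfolding h_def using r by (auto intro!: derivative_eq_intros)
    define p where "p = r powr (\<beta> - 2)"
    have p: "r powr (\<beta> - 1) = r * p"
      using r powr_mult_base[of r "\<beta> - 2"] by (simp add: p_def)
    have "r * \<rho> < r * (f' ?e * (?e * (b * (\<beta> * (r * p)))) * r powr (- 1)
            - b * \<beta> * d * p + (d - \<beta>) * r powr (- 2))"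
      using conv[OF r(2)] r unfolding deriv_\<psi> p \<psi>[OF less_imp_le[OF r(3)]] p_def[symmetric]
      by simp
    also have "\<dots> = f' ?e * (?e * (b * (\<beta> * (r * p)))) - d * (b * (\<beta> * (r * p))) + (d - \<beta>) / r"
      using r by (simp add: powr_minus field_simps power2_eq_square)
    finally show "\<exists>y. (h has_real_derivative y) (at r) \<and> 0 \<le> y"
      using deriv_h unfolding p by (intro exI conjI) (assumption, simp add: mult.commute)
  qed
  define K where "K = exp (h r\<^sub>0 + (d - \<beta>) / \<beta> * ln b)"
  define R where "R = max (exp (b * r\<^sub>0 powr \<beta>)) 2"
  have bound: "K * x powr (d + 1 / 2 * \<rho> * b powr (- 2 / \<beta>) * ln x powr (2 / \<beta> - 1))
        * ln x powr (- (d - \<beta>) / \<beta>) \<le> exp (f x)" if x: "R \<le> x" for x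
  proof -
    have x1: "1 < x" using x by (simp add: R_def)
    define L where "L = ln x"
    have L: "0 < L" using x1 by (simp add: L_def)
    have x_eq: "x = exp L" using x1 by (simp add: L_def)
    define r where "r = (L / b) powr (1 / \<beta>)"
    have r_pos: "0 < r" using L b by (simp add: r_def)
    have r_\<beta>: "b * r powr \<beta> = L" using L b \<beta> by (simp add: r_def powr_powr)
    have "exp (b * r\<^sub>0 powr \<beta>) \<le> exp L" using x unfolding R_def x_eq by simp
    then have "r\<^sub>0 powr \<beta> \<le> L / b" using b by (simp add: field_simps)
    then have "(r\<^sub>0 powr \<beta>) powr (1 / \<beta>) \<le> r"
      unfolding r_def using \<beta> by (intro powr_mono2) auto
    then have "r\<^sub>0 \<le> r" using \<beta> r\<^sub>0_pos by (simp add: powr_powr)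
    from h_mono[OF this] have h: "h r\<^sub>0 \<le> f x - d * L + (d - \<beta>) * ln r - \<rho> / 2 * r\<^sup>2"
      unfolding h_def r_\<beta> x_eq .
    have r2: "r\<^sup>2 = b powr (- 2 / \<beta>) * (L powr (2 / \<beta> - 1) * L)"
    proof -
      have "r\<^sup>2 = r powr 2" using r_pos by (simp add: powr_numeral)
      also have "\<dots> = (L / b) powr (2 / \<beta>)" by (simp add: r_def powr_powr)
      also have "\<dots> = b powr (- 2 / \<beta>) * L powr (2 / \<beta>)"
        using L b by (simp add: powr_divide powr_minus_divide)
      also have "L powr (2 / \<beta>) = L powr (2 / \<beta> - 1) * L"
        using L powr_mult_base[of L "2 / \<beta> - 1"] by (simp add: mult.commute)
      finally show ?thesis .
    qed
    have ln_r: "ln r = (ln L - ln b) / \<beta>" using L b by (simp add: r_def ln_powr ln_div)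
    define A where "A = d + 1 / 2 * \<rho> * b powr (- 2 / \<beta>) * L powr (2 / \<beta> - 1)"
    have "K * x powr A * L powr (- (d - \<beta>) / \<beta>) = K * exp (A * L) * exp (- (d - \<beta>) / \<beta> * ln L)"
      using L x1 by (simp add: powr_def L_def)
    also have "\<dots> = exp (h r\<^sub>0 + (d - \<beta>) / \<beta> * ln b + A * L - (d - \<beta>) / \<beta> * ln L)"
      unfolding K_def exp_add[symmetric] minus_divide_left[symmetric] by (rule arg_cong[where f=exp]) simp
    also have "\<dots> \<le> exp (f x)"
    proof -
      have "(d - \<beta>) * ln r = (d - \<beta>) / \<beta> * ln L - (d - \<beta>) / \<beta> * ln b"
        unfolding ln_r by (simp add: diff_divide_distrib algebra_simps)
      then show ?thesis using h unfolding r2 A_def by (simp add: algebra_simps)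
    qed
    finally show ?thesis by (simp add: A_def L_def)
  qed
  show ?thesis by (rule that[of K R]) (use bound in \<open>auto simp: K_def R_def\<close>)
qed

definition log_power_profile :: "real \<Rightarrow> real \<Rightarrow> real \<Rightarrow> real \<Rightarrow> real \<Rightarrow> real" where
  "log_power_profile a e \<theta> \<gamma> x = x powr (a * ln x powr e - \<theta>) * ln x powr (- \<gamma>)"

lemma log_power_profile_pos: "1 < x \<Longrightarrow> 0 < log_power_profile a e \<theta> \<gamma> x"
  by (simp add: log_power_profile_def)

lemma log_power_profile_growth:
  assumes a: "0 < a" and e: "0 < e \<or> e = 0 \<and> \<theta> < a"
  obtains R \<delta> where "1 < R" "0 < \<delta>"
    "\<And>x y. R \<le> x \<Longrightarrow> x \<le> y \<Longrightarrow>
      log_power_profile a e \<theta> \<gamma> x * (y / x) powr \<delta> \<le> log_power_profile a e \<theta> \<gamma> y"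
proof -
  obtain \<delta> t\<^sub>1 where \<delta>: "0 < \<delta>" and t\<^sub>1: "0 < t\<^sub>1" and large: "\<And>t. t\<^sub>1 \<le> t \<Longrightarrow> \<theta> + 2 * \<delta> \<le> a * (e + 1) * t powr e"
  proof (cases "e = 0")
    case True
    then show thesis using e by (intro that[of "(a - \<theta>) / 2" 1]) (auto simp: field_simps)
  next
    case False
    then have e: "0 < e" using e by auto
    show thesis
    proof (rule that[of 1 "((\<bar>\<theta>\<bar> + 2) / a) powr (1 / e)"])
      fix t assume t: "((\<bar>\<theta>\<bar> + 2) / a) powr (1 / e) \<le> t"
      have "(((\<bar>\<theta>\<bar> + 2) / a) powr (1 / e)) powr e \<le> t powr e"
        using t e by (intro powr_mono2) auto
      then have "(\<bar>\<theta>\<bar> + 2) / a \<le> t powr e" using e a by (simp add: powr_powr)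
      then have "\<bar>\<theta>\<bar> + 2 \<le> a * t powr e" using a by (simp add: field_simps)
      also have "\<dots> \<le> a * (e + 1) * t powr e" using a e by (simp add: algebra_simps)
      finally show "\<theta> + 2 * 1 \<le> a * (e + 1) * t powr e" by simp
    qed (use a in auto)
  qed
  define t\<^sub>2 where "t\<^sub>2 = max t\<^sub>1 (\<bar>\<gamma>\<bar> / \<delta>)"
  have t\<^sub>2: "0 < t\<^sub>2" using t\<^sub>1 by (simp add: t\<^sub>2_def)
  define q where "q t = a * t powr (e + 1) - \<theta> * t - \<gamma> * ln t - \<delta> * t" for t
  have q_mono: "q s \<le> q t" if "t\<^sub>2 \<le> s" "s \<le> t" for s t
  proof (rule DERIV_nonneg_imp_nondecreasing[OF that(2)])
    fix x assume "s \<le> x" "x \<le> t"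
    then have x: "0 < x" "t\<^sub>1 \<le> x" "\<bar>\<gamma>\<bar> / \<delta> \<le> x" using that t\<^sub>2 by (auto simp: t\<^sub>2_def)
    have "(q has_real_derivative a * ((e + 1) * x powr e) - \<theta> - \<gamma> / x - \<delta>) (at x)"
      unfolding q_def using x by (auto intro!: derivative_eq_intros)
    moreover have "\<gamma> / x \<le> \<delta>"
      using x \<delta> by (simp add: field_simps)
    ultimately show "\<exists>y. (q has_real_derivative y) (at x) \<and> 0 \<le> y"
      using large[OF x(2)] by (intro exI conjI) (assumption, simp add: mult.assoc)
  qed
  have profile: "log_power_profile a e \<theta> \<gamma> x = exp (q (ln x) + \<delta> * ln x)" if "1 < x" for x
  proof -
    have L: "0 < ln x" using that by simp
    have "ln x powr (e + 1) = ln x * ln x powr e" using L by (simp add: powr_mult_base add.commute)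
    then show ?thesis
      using L that by (simp add: log_power_profile_def q_def powr_def[of x] powr_def[of "ln x" "- \<gamma>"]
          exp_add[symmetric] algebra_simps)
  qed
  show thesis
  proof (rule that[of "exp t\<^sub>2" \<delta>])
    fix x y assume xy: "exp t\<^sub>2 \<le> x" "x \<le> y"
    have x1: "1 < x" using xy(1) t\<^sub>2 by (smt (verit) one_less_exp_iff)
    then have y1: "1 < y" using xy by simp
    have "t\<^sub>2 \<le> ln x" using xy x1 by (simp add: ln_ge_iff)
    then have "q (ln x) \<le> q (ln y)" using xy x1 by (intro q_mono) auto
    moreover have "(y / x) powr \<delta> = exp (\<delta> * ln y - \<delta> * ln x)"
      using x1 y1 by (simp add: powr_def ln_div algebra_simps)
    ultimately show "log_power_profile a e \<theta> \<gamma> x * (y / x) powr \<delta> \<le> log_power_profile a e \<theta> \<gamma> y"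
      using x1 y1 by (simp add: profile flip: exp_add)
  qed (use t\<^sub>2 \<delta> in auto)
qed

lemma nn_integral_norm_powr_tail:
  assumes R: "0 < R" and \<theta>: "0 < \<theta>"
  shows "(\<integral>\<^sup>+x. ennreal (norm x powr (- (real DIM('a) + \<theta>))) * indicator {x. R \<le> norm x} x
    \<partial>(lborel :: 'a::euclidean_space measure)) < \<top>"
proof -
  let ?d = "real DIM('a)"
  let ?v = "unit_ball_vol ?d"
  define c where "c n = (2 ^ n * R) powr (- (?d + \<theta>))" for n :: nat
  define B where "B n = ball (0 :: 'a) (2 ^ Suc n * R)" for n :: nat
  have [measurable]: "B n \<in> sets borel" for n by (simp add: B_def)
  have "(\<integral>\<^sup>+x. ennreal (norm x powr (- (?d + \<theta>))) * indicator {x. R \<le> norm x} x \<partial>(lborel :: 'a measure))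
     \<le> (\<integral>\<^sup>+x. (\<Sum>n. ennreal (c n) * indicator (B n) x) \<partial>lborel)"
  proof (intro nn_integral_mono)
    fix x :: 'a
    show "ennreal (norm x powr (- (?d + \<theta>))) * indicator {x. R \<le> norm x} x \<le> (\<Sum>n. ennreal (c n) * indicator (B n) x)"
    proof (cases "R \<le> norm x")
      case True
      have "\<exists>n. norm x < 2 ^ n * R"
        using real_arch_pow[of 2 "norm x / R"] R by (auto simp: field_simps)
      then obtain n where n: "norm x < 2 ^ n * R" "\<And>k. k < n \<Longrightarrow> \<not> norm x < 2 ^ k * R"
        using exists_least_iff[of "\<lambda>n. norm x < 2 ^ n * R"] by blast
      then obtain k where k: "n = Suc k" using True by (cases n) auto
      have "ennreal (norm x powr (- (?d + \<theta>))) * indicator {x. R \<le> norm x} x \<le> ennreal (c k) * indicator (B k) x"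
      proof -
        have "2 ^ k * R \<le> norm x" using n(2)[of k] k by simp
        then have "norm x powr (- (?d + \<theta>)) \<le> c k"
          unfolding c_def using R \<theta> by (intro powr_mono2') auto
        moreover have "x \<in> B k" using n(1) k by (simp add: B_def)
        ultimately show ?thesis using True by (simp add: ennreal_leI)
      qed
      also have "\<dots> \<le> (\<Sum>n. ennreal (c n) * indicator (B n) x)"
        using ennreal_suminf_lessD[of "\<lambda>n. ennreal (c n) * indicator (B n) x" _ k] by (meson less_irrefl not_le)
      finally show ?thesis .
    qed simp
  qed
  also have "\<dots> = (\<Sum>n. ennreal (c n) * emeasure lborel (B n))"
    by (subst nn_integral_suminf) (auto simp: nn_integral_cmult_indicator)
  also have "\<dots> = (\<Sum>n. ennreal (?v * 2 ^ DIM('a) * R powr (- \<theta>) * (2 powr (- \<theta>)) ^ n))"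
  proof (intro suminf_cong)
    fix n
    have "c n = (2 powr (- \<theta>)) ^ n * (2 ^ n * R) powr (- ?d) * R powr (- \<theta>)"
    proof -
      have "c n = (2 ^ n * R) powr (- ?d) * (2 ^ n * R) powr (- \<theta>)"
        unfolding c_def by (simp add: powr_add[symmetric])
      also have "(2 ^ n * R) powr (- \<theta>) = (2 powr (- \<theta>)) ^ n * R powr (- \<theta>)"
        using R by (simp add: powr_mult powr_powr mult.commute flip: powr_realpow)
      finally show ?thesis by simp
    qed
    moreover have "(2 ^ n * R) powr (- ?d) * (2 ^ Suc n * R) ^ DIM('a) = 2 ^ DIM('a)"
    proof -
      have "(2 ^ n * R) powr (- ?d) = 1 / (2 ^ n * R) ^ DIM('a)"
        using R by (simp add: powr_minus_divide powr_realpow)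
      moreover have "(2 ^ Suc n * R) ^ DIM('a) = 2 ^ DIM('a) * (2 ^ n * R) ^ DIM('a)"
        by (simp add: power_mult_distrib mult.assoc)
      ultimately show ?thesis using R by simp
    qed
    ultimately have "c n * (?v * (2 ^ Suc n * R) ^ DIM('a)) = ?v * 2 ^ DIM('a) * R powr (- \<theta>) * (2 powr (- \<theta>)) ^ n"
      by (simp add: mult_ac)
    then show "ennreal (c n) * emeasure lborel (B n) = ennreal (?v * 2 ^ DIM('a) * R powr (- \<theta>) * (2 powr (- \<theta>)) ^ n)"
      using R by (simp add: B_def emeasure_ball c_def flip: ennreal_mult)
  qed
  also have "\<dots> < \<top>"
  proof -
    have "2 powr (- \<theta>) < (1 :: real)" using \<theta> by (simp add: powr_minus_divide)
    then have "summable (\<lambda>n. ?v * 2 ^ DIM('a) * R powr (- \<theta>) * (2 powr (- \<theta>)) ^ n)"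
      by (intro summable_mult summable_geometric) simp
    then show ?thesis by (subst less_top[symmetric], intro ennreal_suminf_neq_top) auto
  qed
  finally show ?thesis .
qed

lemma kernel_ge_radial:
  fixes V :: "'a::euclidean_space \<Rightarrow> real"
  assumes "x \<noteq> y" and p: "0 \<le> p"
  obtains z where "0 < norm z" "norm x \<le> norm z"
    "2 powr (- p) * (exp (V z) * norm z powr (- p)) \<le> (exp (V x) + exp (V y)) * norm (x - y) powr (- p)"
proof -
  define z where "z = (if norm x \<le> norm y then y else x)"
  have z: "norm x \<le> norm z" "norm y \<le> norm z" "exp (V z) \<le> exp (V x) + exp (V y)"
    by (auto simp: z_def)
  have pos: "0 < norm z" using z(1,2) \<open>x \<noteq> y\<close> by (cases "z = 0") auto
  have "norm (x - y) \<le> 2 * norm z" using norm_triangle_ineq4[of x y] z by linarith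
  then have "(2 * norm z) powr (- p) \<le> norm (x - y) powr (- p)"
    using \<open>x \<noteq> y\<close> p by (intro powr_mono2') auto
  then have "exp (V z) * (2 * norm z) powr (- p) \<le> (exp (V x) + exp (V y)) * norm (x - y) powr (- p)"
    using z by (intro mult_mono) auto
  then show ?thesis
    using pos z by (intro that[of z]) (auto simp: powr_mult mult_ac)
qed

lemma exp_bounded_below_on_cball:
  fixes V :: "'a::euclidean_space \<Rightarrow> real"
  assumes V: "continuous_on UNIV V" and R: "0 \<le> R"
  obtains c where "0 < c" "\<And>z. norm z \<le> R \<Longrightarrow> c \<le> exp (V z)"
proof -
  have "compact (cball (0 :: 'a) R)" "cball (0 :: 'a) R \<noteq> {}" "continuous_on (cball 0 R) V"
    using R continuous_on_subset[OF V] by auto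
  from continuous_attains_inf[OF this] obtain z\<^sub>1 where "\<forall>z\<in>cball 0 R. V z\<^sub>1 \<le> V z" by blast
  then show ?thesis by (intro that[of "exp (V z\<^sub>1)"]) auto
qed

section \<open>Gibbs measures of radial potentials\<close>

lemma
  fixes V :: "'a::euclidean_space \<Rightarrow> real"
  assumes V: "continuous_on UNIV V" and int: "integrable lborel (\<lambda>x. exp (- V x))"
  shows partition_const_pos: "0 < partition_const V"
    and gibbs_density_normalized: "gibbs_density (normalized V) (gibbs V)"
proof -
  let ?Z = "partition_const V"
  have [measurable]: "V \<in> borel_measurable borel"
    using V by (rule borel_measurable_continuous_onI)
  have nn: "(\<integral>\<^sup>+x. ennreal (exp (- V x)) \<partial>lborel) = ennreal ?Z"
    unfolding partition_const_def by (intro nn_integral_eq_integral int) auto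
  have "?Z \<noteq> 0"
  proof
    assume "?Z = 0"
    then have "(\<integral>\<^sup>+x. ennreal (exp (- V x)) \<partial>lborel) = 0" by (simp add: nn)
    then have "AE x in lborel. ennreal (exp (- V x)) = 0"
      by (subst (asm) nn_integral_0_iff_AE) auto
    then have "AE x in lborel :: 'a measure. False"
      by eventually_elim (auto simp: ennreal_eq_0_iff not_le)
    then show False by (simp add: AE_iff_null null_sets_def)
  qed
  moreover have "0 \<le> ?Z" unfolding partition_const_def by simp
  ultimately show Z: "0 < ?Z" by simp
  have exp: "exp (- normalized V x) = exp (- V x) / ?Z" for x
    using Z by (simp add: normalized_def exp_diff)
  show "gibbs_density (normalized V) (gibbs V)"
  proof
    show "continuous_on UNIV (normalized V)"
      unfolding normalized_def by (intro continuous_intros V)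
    have "(\<integral>\<^sup>+x. ennreal (exp (- normalized V x)) \<partial>lborel)
        = (\<integral>\<^sup>+x. ennreal (1 / ?Z) * ennreal (exp (- V x)) \<partial>lborel)"
      using Z by (simp add: exp flip: ennreal_mult)
    also have "\<dots> = ennreal (1 / ?Z) * ennreal ?Z"
      by (subst nn_integral_cmult) (auto simp: nn)
    also have "\<dots> = 1" using Z by (simp flip: ennreal_mult)
    finally show "(\<integral>\<^sup>+x. ennreal (exp (- normalized V x)) \<partial>lborel) = 1" .
    show "gibbs V = density lborel (\<lambda>x. ennreal (exp (- normalized V x)))"
      by (simp add: gibbs_def exp)
  qed
qed

lemma exp_normalized:
  "0 < partition_const V \<Longrightarrow> exp (normalized V x) = partition_const V * exp (V x)"
  by (simp add: normalized_def exp_add mult.commute)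

lemma omega_profile_eq:
  "omega_profile d \<theta> \<beta> b \<rho> C x = C / 2 powr (real d + \<theta>) *
    log_power_profile (1 / 2 * \<rho> * b powr (- 2 / \<beta>)) (2 / \<beta> - 1) \<theta> ((real d - \<beta>) / \<beta>) x"
  by (simp only: omega_profile_def log_power_profile_def minus_divide_left mult.assoc)

lemma log_power_profile_scale:
  assumes "0 < x"
  shows "x powr (d + a * ln x powr e) * ln x powr (- \<gamma>) = x powr (d + \<theta>) * log_power_profile a e \<theta> \<gamma> x"
  using assms by (simp add: log_power_profile_def mult.assoc[symmetric] flip: powr_add)

lemma super_poincare_gibbs:
  fixes V :: "'a::euclidean_space \<Rightarrow> real" and f :: "real \<Rightarrow> real"
  assumes V: "continuous_on UNIV V" and int: "integrable lborel (\<lambda>x. exp (- V x))"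
    and V_eq: "\<And>x. V x = f (norm x)"
    and \<theta>: "0 < \<theta>" and K: "0 < K"
    and grow: "\<And>x. R\<^sub>1 \<le> x \<Longrightarrow> K * (x powr (real DIM('a) + \<theta>) *
      log_power_profile (1 / 2 * \<rho> * b powr (- 2 / \<beta>)) (2 / \<beta> - 1) \<theta> ((real DIM('a) - \<beta>) / \<beta>) x) \<le> exp (f x)"
    and a: "0 < 1 / 2 * \<rho> * b powr (- 2 / \<beta>)"
    and e: "0 < 2 / \<beta> - 1 \<or> 2 / \<beta> - 1 = 0 \<and> \<theta> < 1 / 2 * \<rho> * b powr (- 2 / \<beta>)"
  shows "\<exists>R\<^sub>0>1. \<forall>R\<ge>R\<^sub>0. \<exists>C>0.
    super_poincare_inequality (gibbs V) \<theta> (super_rate \<theta> V (weight \<theta> \<beta> b \<rho> C R))"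
proof -
  let ?Z = "partition_const V" and ?p = "real DIM('a) + \<theta>"
  let ?v = "unit_ball_vol (real DIM('a))"
  define prof where "prof = log_power_profile (1 / 2 * \<rho> * b powr (- 2 / \<beta>)) (2 / \<beta> - 1) \<theta> ((real DIM('a) - \<beta>) / \<beta>)"
  have Z: "0 < ?Z" by (rule partition_const_pos[OF V int])
  interpret gibbs_density "normalized V" "gibbs V" by (rule gibbs_density_normalized[OF V int])
  have grow: "K * (x powr ?p * prof x) \<le> exp (f x)" if "R\<^sub>1 \<le> x" for x
    using grow[OF that] by (simp add: prof_def)
  obtain R\<^sub>2 \<delta> where R\<^sub>2: "1 < R\<^sub>2" and \<delta>: "0 < \<delta>"
    and prof_grow: "\<And>x y. R\<^sub>2 \<le> x \<Longrightarrow> x \<le> y \<Longrightarrow> prof x * (y / x) powr \<delta> \<le> prof y"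
    using log_power_profile_growth[OF a e, of "(real DIM('a) - \<beta>) / \<beta>"] unfolding prof_def by metis
  have prof_pos: "0 < prof x" if "1 < x" for x
    unfolding prof_def by (rule log_power_profile_pos[OF that])
  have prof_mono: "prof x \<le> prof y" if "R\<^sub>2 \<le> x" "x \<le> y" for x y
  proof -
    have "1 powr \<delta> \<le> (y / x) powr \<delta>" using that R\<^sub>2 \<delta> by (intro powr_mono2) auto
    then have "prof x * 1 \<le> prof x * (y / x) powr \<delta>"
      using prof_pos[of x] that R\<^sub>2 by (intro mult_left_mono) auto
    then show ?thesis using prof_grow[OF that] by simp
  qed
  have prof_lim: "filterlim prof at_top at_top"
  proof (rule filterlim_at_top_mono)
    show "eventually (\<lambda>y. prof R\<^sub>2 * exp (\<delta> * ln (y / R\<^sub>2)) \<le> prof y) at_top"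
      using eventually_ge_at_top[of R\<^sub>2]
    proof eventually_elim
      case (elim y)
      then show ?case using prof_grow[of R\<^sub>2 y] R\<^sub>2 by (simp add: powr_def)
    qed
    have "filterlim (\<lambda>y. 1 / R\<^sub>2 * y) at_top at_top"
      using R\<^sub>2 by (intro filterlim_tendsto_pos_mult_at_top[OF tendsto_const _ filterlim_ident]) auto
    then have "filterlim (\<lambda>y. ln (y / R\<^sub>2)) at_top at_top"
      by (intro filterlim_compose[OF ln_at_top]) simp
    then show "filterlim (\<lambda>y. prof R\<^sub>2 * exp (\<delta> * ln (y / R\<^sub>2))) at_top at_top"
      by (intro filterlim_tendsto_pos_mult_at_top[OF tendsto_const prof_pos[OF R\<^sub>2]]
          filterlim_compose[OF exp_at_top] filterlim_tendsto_pos_mult_at_top[OF tendsto_const \<delta>])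
  qed
  define \<kappa> where "\<kappa> = max 1 (2 * ?Z / ?v)"
  define \<Lambda> where "\<Lambda> = \<kappa> powr \<theta> * max 1 (2 / ?v)"
  have "eventually (\<lambda>t. \<Lambda> * exp (f 0) / K \<le> prof t) at_top"
    using prof_lim by (simp add: filterlim_at_top)
  then obtain R\<^sub>3 where R\<^sub>3: "\<And>t. R\<^sub>3 \<le> t \<Longrightarrow> \<Lambda> * exp (f 0) / K \<le> prof t"
    unfolding eventually_at_top_linorder by auto
  define R\<^sub>0 where "R\<^sub>0 = max R\<^sub>1 (max R\<^sub>2 R\<^sub>3)"
  show ?thesis
  proof (rule exI[of _ R\<^sub>0], intro conjI allI impI)
    show "1 < R\<^sub>0" using R\<^sub>2 by (simp add: R\<^sub>0_def)
    fix R assume "R\<^sub>0 \<le> R"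
    then have R: "R\<^sub>1 \<le> R" "R\<^sub>2 \<le> R" "R\<^sub>3 \<le> R" "1 < R" using R\<^sub>2 by (auto simp: R\<^sub>0_def)
    obtain c where c: "0 < c" "\<And>z. norm z \<le> R \<Longrightarrow> c \<le> exp (V z)"
      using exp_bounded_below_on_cball[OF V, of R] R by auto
    define C where "C = ?Z / 2 * min K (c * R powr (- ?p) / prof R)"
    have C: "0 < C" using Z K c prof_pos[OF R(4)] R by (simp add: C_def)
    define P where "P = omega_profile DIM('a) \<theta> \<beta> b \<rho> C"
    have P_eq: "P x = C / 2 powr ?p * prof x" for x
      by (simp add: P_def omega_profile_eq prof_def)
    have \<omega>_eq: "weight \<theta> \<beta> b \<rho> C R x = P (max R (norm x))" for x :: 'a
      by (simp add: weight_def P_def)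
    have \<omega>_meas: "(weight \<theta> \<beta> b \<rho> C R :: 'a \<Rightarrow> real) \<in> borel_measurable borel"
      unfolding weight_def omega_profile_def by measurable
    have "super_poincare_inequality (gibbs V) \<theta> (super_rate \<theta> V (weight \<theta> \<beta> b \<rho> C R))"
    proof (rule super_poincare_of_weight[where P=P and Z="?Z" and R=R and \<kappa>=\<kappa>, OF \<theta> Z _ _ R(4) _ _ _ \<omega>_eq \<omega>_meas])
      show "normalized V x = V x + ln ?Z" for x by (simp add: normalized_def)
      show "P x \<le> P y" if "R \<le> x" "x \<le> y" for x y
        unfolding P_eq using that R C by (intro mult_left_mono prof_mono) auto
      show "0 < P x" if "R \<le> x" for x
        unfolding P_eq using that R C prof_pos[of x] by simp
      show "filterlim P at_top at_top"
        unfolding P_eq[abs_def] using C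
        by (intro filterlim_tendsto_pos_mult_at_top[OF tendsto_const _ prof_lim]) auto
      show "1 \<le> \<kappa>" "2 * ?Z / ?v \<le> \<kappa>" by (auto simp: \<kappa>_def)
      show "\<exists>z z'::'a. norm z \<le> 2 * t \<and> norm z' \<le> t \<and>
          \<kappa> powr \<theta> * max 1 (2 / ?v) * t * exp (V z') \<le> exp (V z)" if t: "R \<le> t" for t
      proof -
        have t1: "1 < t" using t R by simp
        obtain z :: 'a where z: "norm z = t"
          by (rule vector_choose_size[of t]) (use t1 in auto)
        have "\<Lambda> * exp (f 0) \<le> K * prof t"
          using R\<^sub>3[of t] t R K by (simp add: field_simps)
        then have "t * (\<Lambda> * exp (f 0)) \<le> t * (K * prof t)" using t1 by (intro mult_left_mono) auto
        also have "\<dots> \<le> t powr ?p * (K * prof t)"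
        proof (rule mult_right_mono)
          have "1 \<le> ?p" using DIM_positive[where 'a='a] \<theta> by linarith
          then have "t powr 1 \<le> t powr ?p" using t1 by (rule powr_mono[OF _ less_imp_le])
          then show "t \<le> t powr ?p" using t1 by (simp only: powr_one)
        qed (use K prof_pos[OF t1] in auto)
        also have "\<dots> \<le> exp (f t)" using grow[of t] t R by (simp add: mult_ac)
        finally have "\<kappa> powr \<theta> * max 1 (2 / ?v) * t * exp (V 0) \<le> exp (V z)"
          by (simp add: \<Lambda>_def V_eq z mult_ac)
        then show ?thesis using z t1 by (intro exI[of _ z] exI[of _ "0 :: 'a"]) auto
      qed
      show "2 * weight \<theta> \<beta> b \<rho> C R x
          \<le> (exp (normalized V x) + exp (normalized V y)) * norm (x - y) powr (- ?p)" if xy: "x \<noteq> y" for x y :: 'a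
      proof -
        obtain z where z: "0 < norm z" "norm x \<le> norm z"
          and le: "2 powr (- ?p) * (exp (normalized V z) * norm z powr (- ?p))
            \<le> (exp (normalized V x) + exp (normalized V y)) * norm (x - y) powr (- ?p)"
          by (rule kernel_ge_radial[OF xy, of ?p "normalized V"]) (use \<theta> in auto)
        have "2 * C * prof (max R (norm x)) \<le> ?Z * (exp (V z) * norm z powr (- ?p))"
        proof (cases "R \<le> norm z")
          case True
          have "K * prof (max R (norm x)) \<le> K * prof (norm z)"
            using K R z True by (intro mult_left_mono prof_mono) auto
          also have "\<dots> = K * (norm z powr ?p * norm z powr (- ?p)) * prof (norm z)"
            using z by (simp flip: powr_add)
          also have "\<dots> = K * (norm z powr ?p * prof (norm z)) * norm z powr (- ?p)"
            by (simp only: mult_ac)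
          also have "\<dots> \<le> exp (V z) * norm z powr (- ?p)"
            using grow[of "norm z"] True R by (intro mult_right_mono) (auto simp: V_eq)
          finally have "?Z * (K * prof (max R (norm x))) \<le> ?Z * (exp (V z) * norm z powr (- ?p))"
            using Z by (intro mult_left_mono) auto
          moreover have "2 * C \<le> ?Z * K" using Z by (simp add: C_def)
          then have "2 * C * prof (max R (norm x)) \<le> ?Z * K * prof (max R (norm x))"
            using prof_pos[of "max R (norm x)"] R by (intro mult_right_mono) (auto simp: less_max_iff_disj)
          ultimately show ?thesis by (simp add: mult.assoc)
        next
          case False
          then have "max R (norm x) = R" using z by simp
          have "2 * C = ?Z * min K (c * R powr (- ?p) / prof R)" by (simp add: C_def)
          also have "\<dots> \<le> ?Z * (c * R powr (- ?p) / prof R)"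
            using Z by (intro mult_left_mono min.cobounded2) simp
          finally have "2 * C \<le> ?Z * (c * R powr (- ?p) / prof R)" .
          then have "2 * C * prof R \<le> ?Z * (c * R powr (- ?p) / prof R) * prof R"
            using prof_pos[OF R(4)] by (intro mult_right_mono) auto
          also have "\<dots> = ?Z * (c * R powr (- ?p))" using prof_pos[OF R(4)] by simp
          also have "\<dots> \<le> ?Z * (exp (V z) * norm z powr (- ?p))"
            using Z c False z \<theta> by (intro mult_left_mono mult_mono powr_mono2') auto
          finally show ?thesis using \<open>max R (norm x) = R\<close> by simp
        qed
        then have "2 powr (- ?p) * (2 * C * prof (max R (norm x)))
            \<le> 2 powr (- ?p) * (?Z * (exp (V z) * norm z powr (- ?p)))"
          by (rule mult_left_mono) simp
        also have "\<dots> \<le> (exp (normalized V x) + exp (normalized V y)) * norm (x - y) powr (- ?p)"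
          using le by (simp add: exp_normalized[OF Z] mult.assoc)
        finally have "2 powr (- ?p) * (2 * C * prof (max R (norm x)))
            \<le> (exp (normalized V x) + exp (normalized V y)) * norm (x - y) powr (- ?p)" .
        moreover have "2 powr (- ?p) * (2 * C * prof (max R (norm x))) = 2 * weight \<theta> \<beta> b \<rho> C R x"
          unfolding \<omega>_eq P_eq powr_minus_divide by simp
        ultimately show ?thesis by simp
      qed
      show "(\<integral>\<^sup>+x. ennreal (weight \<theta> \<beta> b \<rho> C R x) \<partial>gibbs V) < \<top>"
      proof -
        let ?c = "C / (2 powr ?p * ?Z * K)"
        let ?tail = "\<lambda>x::'a. ennreal (norm x powr (- ?p)) * indicator {x. R \<le> norm x} x"
        have P_pos: "0 < P x" if "R \<le> x" for x
          unfolding P_eq using that R C prof_pos[of x] by simp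
        have "(\<integral>\<^sup>+x. ennreal (weight \<theta> \<beta> b \<rho> C R x) \<partial>gibbs V)
          = (\<integral>\<^sup>+x. ennreal (exp (- normalized V x)) * ennreal (weight \<theta> \<beta> b \<rho> C R x) \<partial>lborel)"
          by (rule nn_integral_\<mu>) (use \<omega>_meas in measurable)
        also have "\<dots> \<le> (\<integral>\<^sup>+x. ennreal (P R) * ennreal (exp (- normalized V x)) + ennreal ?c * ?tail x \<partial>lborel)"
        proof (intro nn_integral_mono)
          fix x :: 'a
          show "ennreal (exp (- normalized V x)) * ennreal (weight \<theta> \<beta> b \<rho> C R x)
            \<le> ennreal (P R) * ennreal (exp (- normalized V x)) + ennreal ?c * ?tail x"
          proof (cases "R \<le> norm x")
            case False
            then show ?thesis by (simp add: \<omega>_eq max_absorb1 mult.commute)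
          next
            case True
            then have x1: "1 < norm x" using R by simp
            have pos: "0 < K * (norm x powr ?p * prof (norm x))"
              using K prof_pos[OF x1] x1 by (intro mult_pos_pos) auto
            have "exp (- V x) \<le> 1 / (K * (norm x powr ?p * prof (norm x)))"
              using grow[of "norm x"] True R pos by (simp add: V_eq exp_minus inverse_eq_divide frac_le)
            then have "exp (- V x) / ?Z * (C / 2 powr ?p * prof (norm x))
              \<le> 1 / (K * (norm x powr ?p * prof (norm x))) / ?Z * (C / 2 powr ?p * prof (norm x))"
              using Z C prof_pos[OF x1] by (intro mult_right_mono divide_right_mono) auto
            also have "\<dots> = ?c * norm x powr (- ?p)"
              unfolding powr_minus_divide using prof_pos[OF x1] by (simp add: field_simps)
            finally have "exp (- normalized V x) * weight \<theta> \<beta> b \<rho> C R x \<le> ?c * norm x powr (- ?p)"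
              using True Z by (simp add: \<omega>_eq P_eq max_absorb2 exp_minus exp_normalized field_simps)
            then have "ennreal (exp (- normalized V x)) * ennreal (weight \<theta> \<beta> b \<rho> C R x) \<le> ennreal ?c * ?tail x"
              using True C Z K P_pos[of "norm x"]
              by (simp add: \<omega>_eq max_absorb2 ennreal_leI flip: ennreal_mult)
            then show ?thesis by (simp add: add_increasing)
          qed
        qed
        also have "\<dots> = ennreal (P R) * 1 + ennreal ?c * (\<integral>\<^sup>+x. ?tail x \<partial>lborel)"
          by (simp add: nn_integral_add nn_integral_cmult mass)
        also have "\<dots> < \<top>"
          using nn_integral_norm_powr_tail[of R \<theta>, where 'a='a] R \<theta> by (simp add: ennreal_mult_less_top)
        finally show ?thesis .
      qed
    qed simp
    then show "\<exists>C>0. super_poincare_inequality (gibbs V) \<theta> (super_rate \<theta> V (weight \<theta> \<beta> b \<rho> C R))"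
      using C by blast
  qed
qed

lemma poincare_gibbs:
  fixes V :: "'a::euclidean_space \<Rightarrow> real"
  assumes V: "continuous_on UNIV V" and int: "integrable lborel (\<lambda>x. exp (- V x))"
    and \<theta>: "0 < \<theta>" and K: "0 < K" and R: "0 < R"
    and grow: "\<And>x. R \<le> norm x \<Longrightarrow> K * norm x powr (real DIM('a) + \<theta>) \<le> exp (V x)"
  shows "poincare_inequality (gibbs V) \<theta>"
proof -
  let ?Z = "partition_const V" and ?p = "real DIM('a) + \<theta>"
  have Z: "0 < ?Z" by (rule partition_const_pos[OF V int])
  interpret gibbs_density "normalized V" "gibbs V" by (rule gibbs_density_normalized[OF V int])
  obtain c where c: "0 < c" "\<And>z. norm z \<le> R \<Longrightarrow> c \<le> exp (V z)"
    using exp_bounded_below_on_cball[OF V, of R] R by auto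
  define k where "k = min K (c * R powr (- ?p))"
  have k: "0 < k" using K c R by (simp add: k_def)
  have radial: "k \<le> exp (V z) * norm z powr (- ?p)" if "0 < norm z" for z
  proof (cases "R \<le> norm z")
    case True
    have "norm z powr ?p * norm z powr (- ?p) = 1"
      using that by (simp flip: powr_add)
    moreover have "K * norm z powr ?p * norm z powr (- ?p) \<le> exp (V z) * norm z powr (- ?p)"
      using grow[OF True] by (intro mult_right_mono) auto
    ultimately show ?thesis by (simp add: k_def mult.assoc)
  next
    case False
    then have "c * R powr (- ?p) \<le> exp (V z) * norm z powr (- ?p)"
      using c that \<theta> by (intro mult_mono powr_mono2') auto
    then show ?thesis by (simp add: k_def)
  qed
  define \<epsilon> where "\<epsilon> = 2 powr (- ?p) * (?Z * k)"
  have \<epsilon>: "0 < \<epsilon>" using Z k by (simp add: \<epsilon>_def)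
  have "\<epsilon> \<le> (exp (normalized V x) + exp (normalized V y)) * norm (x - y) powr (- ?p)" if xy: "x \<noteq> y" for x y
  proof -
    obtain z where z: "0 < norm z"
      and le: "2 powr (- ?p) * (exp (normalized V z) * norm z powr (- ?p))
            \<le> (exp (normalized V x) + exp (normalized V y)) * norm (x - y) powr (- ?p)"
      by (rule kernel_ge_radial[OF xy, of ?p "normalized V"]) (use \<theta> in auto)
    have "\<epsilon> \<le> 2 powr (- ?p) * (?Z * (exp (V z) * norm z powr (- ?p)))"
      unfolding \<epsilon>_def using Z radial[OF z] by (intro mult_left_mono) auto
    then show ?thesis using le by (simp add: exp_normalized[OF Z] mult.assoc)
  qed
  from poincare_of_kernel_ge[OF _ \<epsilon> this] show ?thesis
    unfolding poincare_inequality_def using \<epsilon> by (intro exI[of _ "1 / \<epsilon>"]) auto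
qed

lemma weak_poincare_gibbs:
  fixes V :: "'a::euclidean_space \<Rightarrow> real"
  assumes V: "continuous_on UNIV V" and int: "integrable lborel (\<lambda>x. exp (- V x))"
    and \<theta>: "0 < \<theta>" and K: "0 < K" and R: "0 < R"
    and bound: "\<And>x. R \<le> norm x \<Longrightarrow> K \<le> exp (V x)"
  shows "weak_poincare_inequality (gibbs V) \<theta> (weak_rate \<theta> (normalized V))"
proof -
  let ?Z = "partition_const V"
  have Z: "0 < ?Z" by (rule partition_const_pos[OF V int])
  interpret gibbs_density "normalized V" "gibbs V" by (rule gibbs_density_normalized[OF V int])
  obtain c where c: "0 < c" "\<And>z. norm z \<le> R \<Longrightarrow> c \<le> exp (V z)"
    using exp_bounded_below_on_cball[OF V, of R] R by auto
  have "min K c \<le> exp (V x)" for x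
    using c(2)[of x] bound[of x] by (cases "R \<le> norm x") auto
  then have "?Z * min K c \<le> exp (normalized V x)" for x
    unfolding exp_normalized[OF Z] using Z by (intro mult_left_mono) auto
  moreover have "0 < ?Z * min K c" using Z K c by simp
  ultimately show ?thesis by (intro weak_poincare_of_bounded_below[OF \<theta>])
qed

theorem proposition4:
  fixes V :: "'a::euclidean_space \<Rightarrow> real"
    and f f' f'' \<psi> :: "real \<Rightarrow> real"
    and \<beta> b \<rho> \<theta> :: real
  assumes beta: "1 < \<beta>" "\<beta> \<le> 2"
    and b: "b > 0"
    and theta: "0 < \<theta>" "\<theta> < 2"
    and psi: "\<And>r. r \<ge> b powr (- 1 / \<beta>) \<Longrightarrow> \<psi> r = exp (b * r powr \<beta>)"
    and isotropic: "\<And>x. V x = f (norm x)"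
    and f': "\<And>r. (f has_real_derivative f' r) (at r)"
    and f'': "\<And>r. (f' has_real_derivative f'' r) (at r)"
    and f''_cont: "continuous_on UNIV f''"
    and integrable: "integrable lborel (\<lambda>x. exp (- V x))"
    and rho: "\<rho> > 0"
    and strong_convexity: "\<exists>N\<^sub>3>0. \<forall>x::'a. norm x > N\<^sub>3 \<longrightarrow>
          f' (\<psi> (norm x)) * deriv \<psi> (norm x) * norm x powr (- 1)
            - b * \<beta> * real DIM('a) * norm x powr (\<beta> - 2)
            + (real DIM('a) - \<beta>) * norm x powr (- 2) > \<rho> \<and>
          f'' (\<psi> (norm x)) * (deriv \<psi> (norm x))\<^sup>2
            + f' (\<psi> (norm x)) * deriv (deriv \<psi>) (norm x)
            - b * \<beta> * (\<beta> - 1) * real DIM('a) * norm x powr (\<beta> - 2)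
            - (real DIM('a) - \<beta>) * norm x powr (- 2) > \<rho>"
  shows "(\<beta> < 2 \<or> \<beta> = 2 \<and> \<theta> < 1 / 2 * \<rho> * b powr (- 1) \<longrightarrow>
            (\<exists>R\<^sub>0>1. \<forall>R\<ge>R\<^sub>0. \<exists>C>0.
               super_poincare_inequality (gibbs V) \<theta>
                 (super_rate \<theta> V (weight \<theta> \<beta> b \<rho> C R))))
       \<and> (\<beta> = 2 \<and> \<theta> = 1 / 2 * \<rho> * b powr (- 1) \<and> DIM('a) \<in> {1, 2} \<longrightarrow>
            poincare_inequality (gibbs V) \<theta>)
       \<and> (\<beta> = 2 \<and> \<theta> = 1 / 2 * \<rho> * b powr (- 1) \<and> DIM('a) \<ge> 3
            \<or> \<beta> = 2 \<and> \<theta> > 1 / 2 * \<rho> * b powr (- 1) \<longrightarrow>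
            weak_poincare_inequality (gibbs V) \<theta> (weak_rate \<theta> (normalized V)))"
proof -
  let ?d = "real DIM('a)"
  let ?a = "1 / 2 * \<rho> * b powr (- 2 / \<beta>)" and ?e = "2 / \<beta> - 1"
  have "continuous_on UNIV f"
    using f' by (intro continuous_at_imp_continuous_on ballI) (rule DERIV_isCont)
  then have "continuous_on UNIV (\<lambda>x::'a. f (norm x))"
    by (rule continuous_on_compose2) (auto intro: continuous_intros)
  then have V: "continuous_on UNIV V" by (simp add: isotropic[abs_def])
  have d1: "1 \<le> ?d" using DIM_positive[where 'a='a] by linarith
  have a: "0 < ?a" using rho b by simp
  have e: "0 \<le> ?e" using beta by (simp add: field_simps)
  obtain N where N: "0 < N" "\<And>x::'a. N < norm x \<Longrightarrow>
        \<rho> < f' (\<psi> (norm x)) * deriv \<psi> (norm x) * norm x powr (- 1)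
            - b * \<beta> * ?d * norm x powr (\<beta> - 2) + (?d - \<beta>) * norm x powr (- 2)"
    using strong_convexity by auto
  have "\<rho> < f' (\<psi> r) * deriv \<psi> r * r powr (- 1) - b * \<beta> * ?d * r powr (\<beta> - 2) + (?d - \<beta>) * r powr (- 2)"
    if r: "N < r" for r
  proof -
    obtain x :: 'a where "norm x = r"
      by (rule vector_choose_size[of r]) (use r N in auto)
    then show ?thesis using N(2)[of x] r by simp
  qed
  note convex = this
  have beta_pos: "0 < \<beta>" using beta by simp
  obtain K R where K: "0 < K" and R: "1 < R" and bound: "\<And>x. R \<le> x \<Longrightarrow>
      K * x powr (?d + ?a * ln x powr ?e) * ln x powr (- (?d - \<beta>) / \<beta>) \<le> exp (f x)"
    by (rule exp_ge_of_radial_convexity[OF beta_pos b, of \<psi> f f' N \<rho> ?d])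
      (rule psi, assumption, rule f', rule convex, assumption, rule that)
  have super: "\<exists>R\<^sub>0>1. \<forall>R\<ge>R\<^sub>0. \<exists>C>0. super_poincare_inequality (gibbs V) \<theta>
      (super_rate \<theta> V (weight \<theta> \<beta> b \<rho> C R))"
    if "\<beta> < 2 \<or> \<beta> = 2 \<and> \<theta> < 1 / 2 * \<rho> * b powr (- 1)"
  proof (rule super_poincare_gibbs[OF V integrable isotropic theta(1) K _ a])
    show "K * (x powr (?d + \<theta>) * log_power_profile ?a ?e \<theta> ((?d - \<beta>) / \<beta>) x) \<le> exp (f x)" if "R \<le> x" for x
    proof -
      have "K * (x powr (?d + ?a * ln x powr ?e) * ln x powr (- ((?d - \<beta>) / \<beta>))) \<le> exp (f x)"
        using bound[OF that] by (simp only: minus_divide_left mult.assoc)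
      moreover have "0 < x" using that R by simp
      note log_power_profile_scale[OF this, of ?d ?a ?e "(?d - \<beta>) / \<beta>" \<theta>]
      ultimately show ?thesis by (simp only:)
    qed
    show "0 < ?e \<or> ?e = 0 \<and> \<theta> < ?a"
      using that
    proof
      assume "\<beta> < 2"
      then have "1 < 2 / \<beta>" using beta_pos by (simp add: less_divide_eq)
      then show ?thesis by simp
    qed simp
  qed
  define R' where "R' = max R (exp 1)"
  have R': "0 < R'" using R by (simp add: R'_def)
  have large: "R \<le> x" "1 < x" "1 \<le> ln x" if "R' \<le> x" for x
    using that R by (auto simp: R'_def ln_ge_iff)
  have poincare: "poincare_inequality (gibbs V) \<theta>"
    if crit: "\<beta> = 2" "\<theta> = 1 / 2 * \<rho> * b powr (- 1)" "DIM('a) \<in> {1, 2}"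
  proof (rule poincare_gibbs[OF V integrable theta(1) K R'])
    fix x :: 'a assume x: "R' \<le> norm x"
    note l = large[OF x]
    have exponent: "?a * ln (norm x) powr ?e = \<theta>" using crit(1,2) l by simp
    have "0 \<le> - (?d - \<beta>) / \<beta>" using crit(1,3) by auto
    then have "1 \<le> ln (norm x) powr (- (?d - \<beta>) / \<beta>)" using l by (intro ge_one_powr_ge_zero)
    then have "K * norm x powr (?d + \<theta>) * 1 \<le> K * norm x powr (?d + \<theta>) * ln (norm x) powr (- (?d - \<beta>) / \<beta>)"
      using K by (intro mult_left_mono) auto
    also have "\<dots> \<le> exp (f (norm x))"
      using bound[OF l(1)] unfolding exponent .
    finally show "K * norm x powr (?d + \<theta>) \<le> exp (V x)" by (simp add: isotropic)
  qed
  have weak: "weak_poincare_inequality (gibbs V) \<theta> (weak_rate \<theta> (normalized V))"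
  proof (rule weak_poincare_gibbs[OF V integrable theta(1) K R'])
    fix x :: 'a assume x: "R' \<le> norm x"
    note l = large[OF x]
    define L where "L = ln (norm x)"
    have "L \<le> norm x - 1" unfolding L_def by (rule ln_le_minus_one) (use l in linarith)
    then have L: "1 \<le> L" "L \<le> norm x" using l by (auto simp: L_def)
    have "norm x powr (- ?d) \<le> L powr (- ?d)" using L by (intro powr_mono2') auto
    also have "\<dots> \<le> L powr (- (?d - \<beta>) / \<beta>)"
    proof (rule powr_mono)
      have "?d * 1 \<le> ?d * \<beta>" using beta by (intro mult_left_mono) auto
      then have "?d - \<beta> \<le> ?d * \<beta>" using beta by linarith
      then show "- ?d \<le> - (?d - \<beta>) / \<beta>" using beta by (simp add: field_simps)
    qed (use L in auto)
    finally have "norm x powr ?d * norm x powr (- ?d)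
        \<le> norm x powr (?d + ?a * L powr ?e) * L powr (- (?d - \<beta>) / \<beta>)"
      using a l by (intro mult_mono powr_mono) auto
    moreover have "norm x powr ?d * norm x powr (- ?d) = 1"
      using l(2) by (auto simp flip: powr_add)
    ultimately have "1 \<le> norm x powr (?d + ?a * L powr ?e) * L powr (- (?d - \<beta>) / \<beta>)"
      by (simp only:)
    then have "K * 1 \<le> K * (norm x powr (?d + ?a * L powr ?e) * L powr (- (?d - \<beta>) / \<beta>))"
      using K by (intro mult_left_mono) auto
    also have "\<dots> \<le> exp (f (norm x))" using bound[OF l(1)] by (simp add: L_def mult.assoc)
    finally show "K \<le> exp (V x)" by (simp add: isotropic)
  qed
  show ?thesis
  proof (intro conjI impI, goal_cases)
    case 1
    then show ?case by (rule super)
  next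
    case 2
    then show ?case using poincare by blast
  next
    case 3
    show ?case by (rule weak)
  qed
qed

end
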